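(* Let $q=2^h$ with $h>1$ and let $n$ be a prime. If $\mathcal{O}$ is a pseudo-oval in $\mathrm{PG}(3n-1,q)$ such that the spread induced by every element of $\mathcal{O}$ is Desarguesian, then $\mathcal{O}$ is elementary.
   Context: Dimensions are projective: an $(n-1)$-space of $\mathrm{PG}(m,q)$ comes from an $n$-dimensional $\mathbb{F}_q$-vector subspace. A pseudo-arc in $\mathrm{PG}(3n-1,q)$ is a set of $(n-1)$-spaces any three distinct elements $E_i,E_j,E_k$ of which satisfy $\langle E_i,E_j\rangle\cap E_k=\emptyset$ (equivalently, any three span the whole space). A pseudo-oval is a pseudo-arc of size $q^n+1$. A partial $(n-1)$-spread of $\mathrm{PG}(2n-1,q)$ is a set of mutually disjoint $(n-1)$-spaces; an $(n-1)$-spread is a set of $(n-1)$-spaces partitioning the point set. An element $E_i$ of a pseudo-arc $\mathcal{A}$ induces the partial spread $\{\langle E_i,E_j\rangle/E_i : E_j\in\mathcal{A},\ j\ne i\}$ of the quotient space $\mathrm{PG}(3n-1,q)/E_i\cong\mathrm{PG}(2n-1,q)$. For a pseudo-oval this partial spread has $q^n$ elements and it is a known fact that it extends uniquely to a spread (the uncovered points form an $(n-1)$-space); this spread is called the spread induced by $E_i$. Field reduction: given an $\mathbb{F}_q$-linear isomorphism $\mathbb{F}_{q^n}^r\cong\mathbb{F}_q^{rn}$, a point of $\mathrm{PG}(r-1,q^n)$, being a 1-dimensional $\mathbb{F}_{q^n}$-subspace, corresponds to an $n$-dimensional $\mathbb{F}_q$-subspace, i.e. an $(n-1)$-space of $\mathrm{PG}(rn-1,q)$.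 A Desarguesian $(n-1)$-spread of $\mathrm{PG}(rn-1,q)$ is the set of $(n-1)$-spaces arising in this way (for some such isomorphism) from all points of $\mathrm{PG}(r-1,q^n)$. A pseudo-arc in $\mathrm{PG}(3n-1,q)$ is elementary if it is obtained by field reduction from an arc (a set of points, no three collinear) of $\mathrm{PG}(2,q^n)$. *)

theory Defs
  imports "HOL-Analysis.Cartesian_Space" "HOL-Library.Set_Algebras"
    "HOL-Computational_Algebra.Primes"
begin

text \<open>
  Projective spaces are handled through the underlying vector spaces: \<open>PG(m - 1, q)\<close> is the
  subspace lattice of \<open>'a ^ 'd\<close> with \<open>CARD('a) = q\<close> and \<open>CARD('d) = m\<close>. An \<open>(m - 1)\<close>-space is a
  vector subspace of dimension \<open>m\<close>, a point is the case \<open>m = 1\<close>, and the empty projective space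
  is \<open>{0}\<close>.
\<close>

definition is_space :: "nat \<Rightarrow> ('a::field ^ 'd::finite) set \<Rightarrow> bool" where
  "is_space m U \<longleftrightarrow> vec.subspace U \<and> vec.dim U = m"

definition pseudo_arc :: "nat \<Rightarrow> ('a::field ^ 'd::finite) set set \<Rightarrow> bool" where
  "pseudo_arc n \<A> \<longleftrightarrow> (\<forall>E\<in>\<A>. is_space n E) \<and>
     (\<forall>E1\<in>\<A>. \<forall>E2\<in>\<A>. \<forall>E3\<in>\<A>. E1 \<noteq> E2 \<and> E1 \<noteq> E3 \<and> E2 \<noteq> E3 \<longrightarrow>
        vec.span (E1 \<union> E2) \<inter> E3 = {0})"

definition pseudo_oval :: "nat \<Rightarrow> ('a::{field,finite} ^ 'd::finite) set set \<Rightarrow> bool" where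
  "pseudo_oval n \<A> \<longleftrightarrow> pseudo_arc n \<A> \<and> card \<A> = CARD('a) ^ n + 1"


subsection \<open>Quotient spaces\<close>

text \<open>
  Vectors of the quotient by a subspace \<open>E\<close> are the cosets \<open>v +o E\<close>; they are added by the addition
  of sets. The scalar multiple of a coset has \<open>E\<close> added again, so that multiplying by \<open>0\<close> gives
  the coset \<open>E\<close> and not the set \<open>{0}\<close>.
\<close>

definition quot :: "('a::field ^ 'd::finite) set \<Rightarrow> ('a ^ 'd) set \<Rightarrow> ('a ^ 'd) set set" where
  "quot U E = (\<lambda>v. v +o E) ` U"

definition quot_scale :: "('a::field ^ 'd::finite) set \<Rightarrow> 'a \<Rightarrow> ('a ^ 'd) set \<Rightarrow> ('a ^ 'd) set" where
  "quot_scale E c X = (\<lambda>v. c *s v) ` X + E"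

lemma quot_add_cosets:
  assumes "vec.subspace E"
  shows "(u +o E) + (v +o E) = (u + v) +o E"
proof -
  have "E + E = E"
  proof
    show "E + E \<subseteq> E"
      using assms by (auto simp: set_plus_def vec.subspace_add)
    show "E \<subseteq> E + E"
      using vec.subspace_0[OF assms] by (metis add_0 set_plus_intro subsetI)
  qed
  then show ?thesis by (simp add: set_plus_rearrange)
qed

lemma quot_scale_coset:
  assumes "vec.subspace E"
  shows "quot_scale E c (v +o E) = (c *s v) +o E"
proof
  show "quot_scale E c (v +o E) \<subseteq> (c *s v) +o E"
    using assms
    by (auto simp: quot_scale_def set_plus_def elt_set_plus_def vec.scale_right_distrib add.assoc
        vec.subspace_add vec.subspace_scale)
  have "v \<in> v +o E"
    using vec.subspace_0[OF assms] by (force simp: elt_set_plus_def)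
  then show "(c *s v) +o E \<subseteq> quot_scale E c (v +o E)"
    by (force simp: quot_scale_def set_plus_def elt_set_plus_def)
qed

text \<open>
  The subspaces of the quotient by \<open>E\<close> are the \<open>quot U E\<close> with \<open>U\<close> a subspace containing \<open>E\<close>,
  of dimension \<open>dim U - dim E\<close>.
\<close>

definition is_quot_space :: "('a::field ^ 'd::finite) set \<Rightarrow> nat \<Rightarrow> ('a ^ 'd) set set \<Rightarrow> bool" where
  "is_quot_space E m W \<longleftrightarrow>
     (\<exists>U. vec.subspace U \<and> E \<subseteq> U \<and> vec.dim U = vec.dim E + m \<and> W = quot U E)"

definition is_quot_spread ::
    "('a::field ^ 'd::finite) set \<Rightarrow> nat \<Rightarrow> ('a ^ 'd) set set set \<Rightarrow> bool" where
  "is_quot_spread E n S \<longleftrightarrow> (\<forall>W\<in>S. is_quot_space E n W) \<and>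
     (\<forall>P. is_quot_space E 1 P \<longrightarrow> (\<exists>!W. W \<in> S \<and> P \<subseteq> W))"

definition induced_partial_spread ::
    "('a::field ^ 'd::finite) set set \<Rightarrow> ('a ^ 'd) set \<Rightarrow> ('a ^ 'd) set set set" where
  "induced_partial_spread \<A> E = {quot (vec.span (E \<union> F)) E | F. F \<in> \<A> \<and> F \<noteq> E}"

text \<open>For a pseudo-oval the extension to a spread exists and is unique.\<close>

definition induced_spread ::
    "nat \<Rightarrow> ('a::field ^ 'd::finite) set set \<Rightarrow> ('a ^ 'd) set \<Rightarrow> ('a ^ 'd) set set set" where
  "induced_spread n \<A> E =
     (THE S. is_quot_spread E n S \<and> induced_partial_spread \<A> E \<subseteq> S)"


subsection \<open>Field reduction\<close>

text \<open>The extension field is a type \<open>'k\<close> together with an embedding of \<open>'a\<close>.\<close>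

definition field_embedding :: "('a::field \<Rightarrow> 'k::field) \<Rightarrow> bool" where
  "field_embedding \<iota> \<longleftrightarrow> \<iota> 1 = 1 \<and>
     (\<forall>x y. \<iota> (x + y) = \<iota> x + \<iota> y) \<and> (\<forall>x y. \<iota> (x * y) = \<iota> x * \<iota> y)"

text \<open>
  \<open>'a\<close>-linear isomorphisms from \<open>'k ^ 'r\<close> onto the \<open>'a\<close>-vector space with carrier \<open>C\<close>, addition
  \<open>add\<close> and scalar multiplication \<open>scl\<close>; the carrier is explicit so that quotients are covered.
\<close>

definition reduction_iso ::
    "('a::field \<Rightarrow> 'k::field) \<Rightarrow> 'x set \<Rightarrow> ('x \<Rightarrow> 'x \<Rightarrow> 'x) \<Rightarrow> ('a \<Rightarrow> 'x \<Rightarrow> 'x) \<Rightarrow>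
       ('k ^ 'r::finite \<Rightarrow> 'x) \<Rightarrow> bool" where
  "reduction_iso \<iota> C add scl \<phi> \<longleftrightarrow> bij_betw \<phi> UNIV C \<and>
     (\<forall>x y. \<phi> (x + y) = add (\<phi> x) (\<phi> y)) \<and> (\<forall>c x. \<phi> (\<iota> c *s x) = scl c (\<phi> x))"

definition field_reduction :: "('k::field ^ 'r::finite \<Rightarrow> 'x) \<Rightarrow> ('k ^ 'r) set set \<Rightarrow> 'x set set" where
  "field_reduction \<phi> \<P> = (\<lambda>P. \<phi> ` P) ` \<P>"

definition desarguesian_quot_spread ::
    "('a::field \<Rightarrow> 'k::field) \<Rightarrow> ('a ^ 'd::finite) set \<Rightarrow> ('a ^ 'd) set set set \<Rightarrow> bool" where
  "desarguesian_quot_spread \<iota> E S \<longleftrightarrow>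
     (\<exists>\<phi> :: 'k ^ 2 \<Rightarrow> ('a ^ 'd) set.
        reduction_iso \<iota> (quot UNIV E) (+) (quot_scale E) \<phi> \<and>
        S = field_reduction \<phi> {P. is_space 1 P})"

definition is_arc :: "('k::field ^ 3) set set \<Rightarrow> bool" where
  "is_arc \<P> \<longleftrightarrow> (\<forall>P\<in>\<P>. is_space 1 P) \<and>
     (\<forall>P\<in>\<P>. \<forall>Q\<in>\<P>. \<forall>R\<in>\<P>. P \<noteq> Q \<and> P \<noteq> R \<and> Q \<noteq> R \<longrightarrow>
        \<not> (\<exists>L. is_space 2 L \<and> P \<subseteq> L \<and> Q \<subseteq> L \<and> R \<subseteq> L))"

definition elementary :: "('a::field \<Rightarrow> 'k::field) \<Rightarrow> ('a ^ 'd::finite) set set \<Rightarrow> bool" where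
  "elementary \<iota> \<A> \<longleftrightarrow>
     (\<exists>(\<phi> :: 'k ^ 3 \<Rightarrow> 'a ^ 'd) \<P>.
        reduction_iso \<iota> UNIV (+) (*s) \<phi> \<and> is_arc \<P> \<and> \<A> = field_reduction \<phi> \<P>)"

end

theory Submission
  imports Defs
begin

text \<open>
  The Desarguesian spread at \<open>E\<close> amounts to a linear map \<open>\<pi>\<close> onto \<open>K ^ 2\<close>, \<open>K = GF(q ^ n)\<close>, with
  kernel \<open>E\<close> which sends all other elements to points. In a frame \<open>X, Y, Z, G\<close> of elements of the
  pseudo-oval the space becomes \<open>W\<^sup>3\<close>, and every further element is \<open>{(w, \<alpha> w, \<beta> w)}\<close>, where \<open>\<alpha>\<close>,
  \<open>\<beta>\<close> and \<open>\<beta> / \<alpha>\<close> range over copies \<open>K\<^sub>1, K\<^sub>2, K\<^sub>3\<close> of \<open>K\<close> in \<open>End W\<close>, one for each of the spreads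
  at \<open>Z, Y, X\<close>. If \<open>K\<^sub>1 = K\<^sub>2\<close>, all elements are \<open>K\<^sub>1\<close>-subspaces and the pseudo-oval is elementary.

  Otherwise \<open>K\<^sub>1\<close> and \<open>K\<^sub>2\<close> share only \<open>GF(q)\<close>, because \<open>n\<close> is prime. Let \<open>\<beta> = f \<alpha>\<close>. The frame
  \<open>G, Y, Z, H\<close> with \<open>H\<close> given by \<open>(a, f a)\<close> has the same \<open>K\<^sub>1, K\<^sub>2\<close>, with coefficients
  \<open>(\<alpha> - 1) / (a - 1)\<close> and \<open>(\<beta> - 1) / (f a - 1)\<close>; if the first is in \<open>GF(q)\<close>, so is the second.
  Hence \<open>f (1 + t (a - 1)) = 1 + g (f a - 1)\<close> with \<open>t, g\<close> in \<open>GF(q)\<close>, and dividing by the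
  arguments inside \<open>K\<^sub>3\<close> puts \<open>a\<close> or \<open>f a\<close> into \<open>GF(q)\<close>, although both can be chosen outside.
\<close>

section \<open>Subspaces over a finite field\<close>

lemma card_subspace:
  fixes U :: "('a::{field,finite} ^ 'd::finite) set"
  assumes "vec.subspace U"
  shows "card U = CARD('a) ^ vec.dim U"
proof -
  obtain B where B: "B \<subseteq> U" "vec.independent B" "U \<subseteq> vec.span B" "card B = vec.dim U"
    using vec.basis_exists by blast
  have fin: "finite B" by (rule vec.finiteI_independent[OF B(2)])
  have span: "vec.span B = U"
    using B assms by (simp add: subset_antisym vec.span_minimal)
  let ?f = "\<lambda>u. \<Sum>v\<in>B. u v *s v"
  have inj: "inj_on ?f (B \<rightarrow>\<^sub>E UNIV)"
  proof (rule inj_onI)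
    fix u w assume u: "u \<in> B \<rightarrow>\<^sub>E (UNIV :: 'a set)" and w: "w \<in> B \<rightarrow>\<^sub>E (UNIV :: 'a set)"
      and "?f u = ?f w"
    then have "(\<Sum>v\<in>B. (u v - w v) *s v) = 0"
      by (simp add: vec.scale_left_diff_distrib sum_subtractf)
    then have "\<forall>v\<in>B. u v - w v = 0"
      using B(2)[unfolded vec.independent_explicit_finite_subsets, rule_format, of B "\<lambda>v. u v - w v"]
        fin by simp
    then show "u = w" by (intro PiE_ext[OF u w]) auto
  qed
  have "?f ` (B \<rightarrow>\<^sub>E UNIV) = U"
  proof -
    have "?f ` (B \<rightarrow>\<^sub>E UNIV) = range ?f"
    proof (intro equalityI image_subsetI)
      fix u :: "('a,'d) vec \<Rightarrow> 'a"
      have "?f u = ?f (restrict u B)" by (intro sum.cong) auto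
      moreover have "?f (restrict u B) \<in> ?f ` (B \<rightarrow>\<^sub>E UNIV)" by (rule imageI) auto
      ultimately show "?f u \<in> ?f ` (B \<rightarrow>\<^sub>E UNIV)" by simp
    qed auto
    then show ?thesis using vec.span_finite[OF fin] span by simp
  qed
  then have "card U = card (B \<rightarrow>\<^sub>E (UNIV :: 'a set))"
    using card_image[OF inj] by argo
  then show ?thesis using B(4) fin by (simp add: card_PiE)
qed

lemma mem_span_Un:
  assumes "vec.subspace E" "vec.subspace F"
  shows "v \<in> vec.span (E \<union> F) \<longleftrightarrow> (\<exists>e\<in>E. \<exists>f\<in>F. v = e + f)"
  using assms by (auto simp: vec.span_Un vec.span_eq_iff[THEN iffD2])

text \<open>Scaling by an element outside \<open>{0, 1}\<close> permutes the subspace.\<close>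

lemma sum_subspace_eq_0:
  fixes U :: "('a::{field,finite} ^ 'd::finite) set"
  assumes "vec.subspace U" and "CARD('a) > 2"
  shows "\<Sum>U = 0"
proof -
  have "\<not> (UNIV :: 'a set) \<subseteq> {0, 1}"
  proof
    assume "(UNIV :: 'a set) \<subseteq> {0, 1}"
    then have "CARD('a) \<le> card {0::'a, 1}" by (intro card_mono) auto
    then show False using assms(2) by simp
  qed
  then obtain c :: 'a where c: "c \<noteq> 0" "c \<noteq> 1" by auto
  have "bij_betw ((*s) c) U U"
  proof (rule bij_betwI[where g = "(*s) (inverse c)"])
    show "(*s) c \<in> U \<rightarrow> U" "(*s) (inverse c) \<in> U \<rightarrow> U"
      using assms(1) by (auto simp: vec.subspace_scale)
  qed (use c in auto)
  then have "\<Sum>U = (\<Sum>u\<in>U. c *s u)"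
    using sum.reindex_bij_betw[of "(*s) c" U U "\<lambda>x. x"] by simp
  also have "\<dots> = c *s \<Sum>U" by (rule vec.scale_sum_right[symmetric])
  finally have "(1 - c) *s \<Sum>U = 0"
    unfolding vec.scale_left_diff_distrib by simp
  then show ?thesis using c by auto
qed

text \<open>Adding 1 permutes the ring, so the sum of all its elements does not change when each
  summand grows by 1.\<close>

lemma of_nat_CARD_eq_0: "of_nat CARD('a::{ring_1,finite}) = (0 :: 'a)"
proof -
  have "(\<Sum>x\<in>UNIV. x + 1) = (\<Sum>x\<in>(UNIV :: 'a set). x)"
    by (rule sum.reindex_bij_betw[of "\<lambda>x. x + 1" UNIV UNIV "\<lambda>x. x"])
      (auto intro!: bij_betwI[where g = "\<lambda>x. x - 1"])
  then show ?thesis by (simp add: sum.distrib)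
qed

section \<open>Tangent spaces and induced spreads\<close>

lemma mem_quot:
  assumes "vec.subspace E" "vec.subspace U" "E \<subseteq> U"
  shows "v +o E \<in> quot U E \<longleftrightarrow> v \<in> U"
proof
  assume "v +o E \<in> quot U E"
  then obtain u where u: "u \<in> U" "v +o E = u +o E" by (auto simp: quot_def)
  have "v \<in> v +o E" using vec.subspace_0[OF assms(1)] by (force simp: elt_set_plus_def)
  then have "v \<in> u +o E" using u by simp
  then obtain e where "e \<in> E" "v = u + e" by (auto simp: elt_set_plus_def)
  then show "v \<in> U" using u assms by (auto intro: vec.subspace_add)
qed (auto simp: quot_def)

lemma quot_subset_iff:
  assumes "vec.subspace E" "vec.subspace U" "E \<subseteq> U" "vec.subspace U'" "E \<subseteq> U'"
  shows "quot U E \<subseteq> quot U' E \<longleftrightarrow> U \<subseteq> U'"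
proof
  assume "quot U E \<subseteq> quot U' E"
  then show "U \<subseteq> U'" using mem_quot[OF assms(1,2,3)] mem_quot[OF assms(1,4,5)] by blast
qed (auto simp: quot_def)

section \<open>Joins and direct sum decompositions in a pseudo-oval\<close>

locale pseudo_oval_space =
  fixes n :: nat and \<O> :: "('a::{field,finite} ^ 'd::finite) set set"
  assumes arc: "pseudo_arc n \<O>"
    and card_oval: "card \<O> = CARD('a) ^ n + 1"
    and dim_space: "CARD('d) = 3 * n"
    and card_scalars: "CARD('a) \<ge> 4"
    and n_gt_1: "n > 1"
begin

lemma finite_oval: "finite \<O>"
  using card_oval by (metis add_is_0 card.infinite one_neq_zero)

lemma subspace: "E \<in> \<O> \<Longrightarrow> vec.subspace E"
  and dim_elem: "E \<in> \<O> \<Longrightarrow> vec.dim E = n"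
  using arc by (auto simp: pseudo_arc_def is_space_def)

lemma card_elem: "E \<in> \<O> \<Longrightarrow> card E = CARD('a) ^ n"
  by (simp add: card_subspace subspace dim_elem)

lemma joinI: "e \<in> E \<Longrightarrow> f \<in> F \<Longrightarrow> e + f \<in> vec.span (E \<union> F)"
  by (intro vec.span_add vec.span_base) auto

lemma joinE:
  assumes "v \<in> vec.span (E \<union> F)" "E \<in> \<O>" "F \<in> \<O>"
  obtains e f where "e \<in> E" "f \<in> F" "v = e + f"
  using assms mem_span_Un subspace by blast

lemma join_disjoint:
  assumes "E \<in> \<O>" "F \<in> \<O>" "G \<in> \<O>" "E \<noteq> F" "E \<noteq> G" "F \<noteq> G" "v \<in> vec.span (E \<union> F)" "v \<in> G"
  shows "v = 0"
proof -
  have "vec.span (E \<union> F) \<inter> G = {0}"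
    using arc assms(1-6) unfolding pseudo_arc_def by blast
  then show ?thesis using assms(7,8) by blast
qed

lemma card_gt_3: "card \<O> > 3"
proof -
  have "CARD('a) ^ 1 \<le> CARD('a) ^ n"
    using card_scalars n_gt_1 by (intro power_increasing) auto
  then show ?thesis using card_oval card_scalars by simp
qed

text \<open>Supplies further elements one at a time, up to the four of a frame.\<close>

lemma avoid:
  assumes "card S \<le> 3" "finite S"
  shows "\<exists>G\<in>\<O>. G \<notin> S"
proof (rule ccontr)
  assume "\<not> (\<exists>G\<in>\<O>. G \<notin> S)"
  then have "card \<O> \<le> card S" using assms by (intro card_mono) auto
  then show False using card_gt_3 assms by simp
qed

text \<open>\<open>pseudo_arc\<close> speaks of triples only, so a third element \<open>G\<close> is
  added: a common vector of \<open>E\<close> and \<open>F\<close> lies in the join of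
  \<open>E\<close> and \<open>G\<close> as well as in \<open>F\<close>.\<close>

lemma disjoint:
  assumes "E \<in> \<O>" "F \<in> \<O>" "E \<noteq> F" "v \<in> E" "v \<in> F"
  shows "v = 0"
proof -
  have "card {E, F} \<le> 3" by (simp add: card_insert_if)
  then obtain G where G: "G \<in> \<O>" "G \<notin> {E, F}"
    using avoid by blast
  have "v \<in> vec.span (E \<union> G)" using assms by (simp add: vec.span_base)
  then show ?thesis using join_disjoint[of E G F v] G assms by auto
qed

text \<open>This is the disjointness of the induced partial spread in the quotient by
  \<open>E\<close>. From e + f = e' + g it follows that g lies in the join of \<open>E\<close> and
  \<open>F\<close>, hence is 0.\<close>

lemma joins_meet:
  assumes "E \<in> \<O>" "F \<in> \<O>" "G \<in> \<O>" "E \<noteq> F" "E \<noteq> G" "F \<noteq> G"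
    "v \<in> vec.span (E \<union> F)" "v \<in> vec.span (E \<union> G)"
  shows "v \<in> E"
proof -
  obtain e f where ef: "e \<in> E" "f \<in> F" "v = e + f" using assms joinE by metis
  obtain e' g where eg: "e' \<in> E" "g \<in> G" "v = e' + g" using assms joinE by metis
  have "e - e' \<in> E" using ef eg subspace[OF assms(1)] by (simp add: vec.subspace_diff)
  then have "(e - e') + f \<in> vec.span (E \<union> F)" using ef joinI by blast
  moreover have "g = (e - e') + f" using ef eg by (simp add: algebra_simps)
  ultimately have "g \<in> vec.span (E \<union> F)" by simp
  then have "g = 0" using join_disjoint[of E F G g] assms eg by auto
  then show ?thesis using eg by simp
qed

text \<open>Addition is injective on E x F x G, which has q^(3n) elements, as many as the whole
  space. So the space is the direct sum of any three elements.\<close>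

lemma decompose:
  assumes "E \<in> \<O>" "F \<in> \<O>" "G \<in> \<O>" "E \<noteq> F" "E \<noteq> G" "F \<noteq> G"
  shows "\<exists>g\<in>G. v - g \<in> vec.span (E \<union> F)"
proof -
  let ?f = "\<lambda>(e, f, g). e + f + g"
  have zero: "g = 0 \<and> f = 0 \<and> e = 0" if "e \<in> E" "f \<in> F" "g \<in> G" "e + f + g = 0" for e f g
  proof -
    have "- g = e + f" using that by (metis minus_unique add.commute)
    then have "- g \<in> vec.span (E \<union> F)" using that joinI by simp
    moreover have "- g \<in> G" using that assms subspace vec.subspace_neg by blast
    ultimately have g: "g = 0" using join_disjoint[of E F G "- g"] assms by simp
    then have "f = - e" using that by (simp add: eq_neg_iff_add_eq_0 add.commute)
    then have "f \<in> E" using that subspace assms vec.subspace_neg by blast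
    then have "f = 0" using disjoint assms that by blast
    with g that show ?thesis by simp
  qed
  have "inj_on ?f (E \<times> F \<times> G)"
  proof (rule inj_onI)
    fix p p' assume p: "p \<in> E \<times> F \<times> G" and p': "p' \<in> E \<times> F \<times> G" and eq: "?f p = ?f p'"
    obtain e f g where p_eq: "p = (e, f, g)" by (cases p)
    obtain e' f' g' where p'_eq: "p' = (e', f', g')" by (cases p')
    have "e - e' + (f - f') + (g - g') = 0"
      using eq p_eq p'_eq by (simp add: algebra_simps)
    moreover have "e - e' \<in> E" "f - f' \<in> F" "g - g' \<in> G"
      using p p' p_eq p'_eq subspace assms by (auto intro: vec.subspace_diff)
    ultimately have "g - g' = 0 \<and> f - f' = 0 \<and> e - e' = 0" using zero by blast
    then show "p = p'" using p_eq p'_eq by simp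
  qed
  then have "card (?f ` (E \<times> F \<times> G)) = CARD('a) ^ n * (CARD('a) ^ n * CARD('a) ^ n)"
    by (simp only: card_image card_cartesian_product card_elem assms)
  also have "\<dots> = CARD('a) ^ CARD('d)"
    by (simp add: dim_space mult.commute[of 3] power_mult power3_eq_cube mult.assoc)
  also have "\<dots> = CARD('a ^ 'd)" by simp
  finally have "?f ` (E \<times> F \<times> G) = UNIV"
    by (intro card_subset_eq) auto
  then have "v \<in> ?f ` (E \<times> F \<times> G)" by simp
  then obtain e f g where "e \<in> E" "f \<in> F" "g \<in> G" "v = e + f + g" by auto
  moreover from this have "v - g \<in> vec.span (E \<union> F)" using joinI by simp
  ultimately show ?thesis by blast
qed

text \<open>The projection onto \<open>G\<close> along the join of \<open>E\<close> and
  \<open>F\<close>.\<close>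

definition component :: "('a ^ 'd) set \<Rightarrow> ('a ^ 'd) set \<Rightarrow> ('a ^ 'd) set \<Rightarrow> 'a ^ 'd \<Rightarrow> 'a ^ 'd" where
  "component E F G v = (THE g. g \<in> G \<and> v - g \<in> vec.span (E \<union> F))"

context
  fixes E F G
  assumes EFG: "E \<in> \<O>" "F \<in> \<O>" "G \<in> \<O>" "E \<noteq> F" "E \<noteq> G" "F \<noteq> G"
begin

lemma component_ex1: "\<exists>!g. g \<in> G \<and> v - g \<in> vec.span (E \<union> F)"
proof (rule ex_ex1I)
  show "\<exists>g. g \<in> G \<and> v - g \<in> vec.span (E \<union> F)"
    using decompose[OF EFG] by blast
next
  fix g g' assume g: "g \<in> G \<and> v - g \<in> vec.span (E \<union> F)" "g' \<in> G \<and> v - g' \<in> vec.span (E \<union> F)"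
  then have "(v - g') - (v - g) \<in> vec.span (E \<union> F)"
    using vec.span_diff by blast
  moreover have "g - g' \<in> G" using g EFG subspace vec.subspace_diff by blast
  ultimately have "g - g' = 0" using join_disjoint[OF EFG, of "g - g'"] by simp
  then show "g = g'" by simp
qed

lemma component_mem: "component E F G v \<in> G"
  and component_diff: "v - component E F G v \<in> vec.span (E \<union> F)"
  using theI'[OF component_ex1] unfolding component_def by blast+

lemma component_eqI: "g \<in> G \<Longrightarrow> v - g \<in> vec.span (E \<union> F) \<Longrightarrow> component E F G v = g"
  using component_ex1 component_mem component_diff by blast

lemma component_add: "component E F G (u + v) = component E F G u + component E F G v"
proof (rule component_eqI)
  show "component E F G u + component E F G v \<in> G"
    using component_mem subspace EFG vec.subspace_add by blast
  have "(u - component E F G u) + (v - component E F G v) \<in> vec.span (E \<union> F)"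
    using component_diff vec.span_add by blast
  then show "u + v - (component E F G u + component E F G v) \<in> vec.span (E \<union> F)"
    by (simp add: algebra_simps)
qed

lemma component_scale: "component E F G (c *s v) = c *s component E F G v"
proof (rule component_eqI)
  show "c *s component E F G v \<in> G"
    using component_mem subspace EFG vec.subspace_scale by blast
  have "c *s (v - component E F G v) \<in> vec.span (E \<union> F)"
    using component_diff vec.span_scale by blast
  then show "c *s v - c *s component E F G v \<in> vec.span (E \<union> F)"
    by (simp add: vec.scale_right_diff_distrib)
qed

lemma component_id: "v \<in> G \<Longrightarrow> component E F G v = v"
  by (intro component_eqI) (auto simp: vec.span_zero)

lemma component_eq_0_iff: "component E F G v = 0 \<longleftrightarrow> v \<in> vec.span (E \<union> F)"
  using component_diff[of v] component_eqI[of 0 v] vec.subspace_0[OF subspace[OF EFG(3)]] by auto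

end

lemma card_rest:
  assumes "E \<in> \<O>" "G \<in> \<O>" "E \<noteq> G"
  shows "card (\<O> - {E, G}) = CARD('a) ^ n - 1"
  using assms finite_oval card_oval by (simp add: card_Diff_insert)

text \<open>There are q^n - 1 summands, and q = 0 in the field.\<close>

lemma sum_rest_const:
  assumes "E \<in> \<O>" "G \<in> \<O>" "E \<noteq> G"
  shows "(\<Sum>F\<in>\<O> - {E, G}. v) = - (v :: 'a ^ 'd)"
proof -
  have *: "(\<Sum>F\<in>S. v) = of_nat (card S) *s v" for S :: "('a ^ 'd) set set"
  proof (induction S rule: infinite_finite_induct)
    case (insert F S)
    then show ?case by (simp add: vec.scale_left_distrib del: sum_constant)
  qed auto
  have "CARD('a) ^ n \<ge> 1" using card_scalars by simp
  then have "of_nat (CARD('a) ^ n - 1) = (of_nat (CARD('a) ^ n) - 1 :: 'a)"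
    by (simp add: of_nat_diff)
  then show ?thesis
    using n_gt_1 unfolding * card_rest[OF assms] by (simp add: of_nat_CARD_eq_0 power_0_left)
qed

section \<open>The trace map and the tangent space at an element\<close>

definition trace_map :: "('a ^ 'd) set \<Rightarrow> ('a ^ 'd) set \<Rightarrow> 'a ^ 'd \<Rightarrow> 'a ^ 'd" where
  "trace_map E G v = (\<Sum>F\<in>\<O> - {E, G}. component E F G v)"

text \<open>Off \<open>\<langle>E, G\<rangle>\<close> the components of \<open>v\<close> are \<open>q ^ n - 1\<close> distinct vectors of \<open>G\<close>; as \<open>G\<close> sums to \<open>0\<close>,
  \<open>trace_map\<close> returns minus the missing one, so its kernel consists of the vectors on no
  \<open>\<langle>E, F\<rangle>\<close>. This proves that these vectors, together with \<open>E\<close>, form a subspace.\<close>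

lemma trace_map_eq_0_iff:
  assumes EG: "E \<in> \<O>" "G \<in> \<O>" "E \<noteq> G" and v: "v \<notin> E"
  shows "trace_map E G v = 0 \<longleftrightarrow> (\<forall>F\<in>\<O> - {E}. v \<notin> vec.span (E \<union> F))"
proof -
  note card_rest = card_rest[OF EG]
  show ?thesis
  proof (cases "v \<in> vec.span (E \<union> G)")
    case True
    then obtain e g where eg: "e \<in> E" "g \<in> G" "v = e + g" using EG joinE by metis
    \<comment> \<open>Every component of e + g is g, as the remainder e lies in \<open>E\<close>.
      Since v is outside \<open>E\<close>, g is not 0, and \<open>F = G\<close> refutes the
      right-hand side.\<close>
    have "component E F G v = g" if "F \<in> \<O> - {E, G}" for F
    proof (rule component_eqI)
      show "v - g \<in> vec.span (E \<union> F)" using eg by (simp add: vec.span_base)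
    qed (use that EG eg in auto)
    then have "trace_map E G v = (\<Sum>F\<in>\<O> - {E, G}. g)"
      unfolding trace_map_def by (rule sum.cong[OF refl])
    also have "\<dots> = - g" by (rule sum_rest_const[OF EG])
    finally have "trace_map E G v = - g" .
    moreover have "g \<noteq> 0" using eg v by auto
    ultimately show ?thesis using True EG by auto
  next
    case False
    let ?C = "(\<lambda>F. component E F G v) ` (\<O> - {E, G})"
    \<comment> \<open>If two components agree, v minus this component lies in two joins with
      \<open>E\<close>, hence in \<open>E\<close>, and v lies in the join of \<open>E\<close> and
      \<open>G\<close>.\<close>
    have "inj_on (\<lambda>F. component E F G v) (\<O> - {E, G})"
    proof (rule inj_onI, rule ccontr)
      fix F F' assume F: "F \<in> \<O> - {E, G}" and F': "F' \<in> \<O> - {E, G}" and "F \<noteq> F'"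
        and eq: "component E F G v = component E F' G v"
      have "v - component E F G v \<in> E"
      proof (rule joins_meet[of E F F'])
        show "v - component E F G v \<in> vec.span (E \<union> F)"
          using F EG by (intro component_diff) auto
        show "v - component E F G v \<in> vec.span (E \<union> F')"
          unfolding eq using F' EG by (intro component_diff) auto
      qed (use F F' EG \<open>F \<noteq> F'\<close> in auto)
      moreover have "component E F G v \<in> G" using F EG by (intro component_mem) auto
      ultimately have "v - component E F G v + component E F G v \<in> vec.span (E \<union> G)"
        by (rule joinI)
      then have "v \<in> vec.span (E \<union> G)" by simp
      then show False using False by simp
    qed
    then have card_C: "card ?C = CARD('a) ^ n - 1"
      and sum_C: "trace_map E G v = \<Sum>?C"
      by (simp_all add: card_image card_rest trace_map_def sum.reindex)
    have sub: "?C \<subseteq> G" using EG by (auto intro!: component_mem)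
    have "card (G - ?C) = 1"
      using sub card_C card_elem[OF EG(2)] card_scalars
      by (subst card_Diff_subset) auto
    then obtain w where w: "G - ?C = {w}" by (auto simp: card_1_singleton_iff)
    have "\<Sum>G = \<Sum>(G - ?C) + \<Sum>?C"
      by (rule sum.subset_diff[OF sub]) simp
    moreover have "\<Sum>G = 0" using subspace[OF EG(2)] card_scalars by (intro sum_subspace_eq_0) auto
    ultimately have "w + trace_map E G v = 0" using w sum_C by simp
    then have trace: "trace_map E G v = - w" by (rule minus_unique[symmetric])
    have w_0: "w = 0 \<longleftrightarrow> 0 \<notin> ?C"
      using w vec.subspace_0[OF subspace[OF EG(2)]] by auto
    have "0 \<in> ?C \<longleftrightarrow> (\<exists>F\<in>\<O> - {E, G}. v \<in> vec.span (E \<union> F))"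
    proof -
      have "component E F G v = 0 \<longleftrightarrow> v \<in> vec.span (E \<union> F)" if "F \<in> \<O> - {E, G}" for F
        using that EG by (intro component_eq_0_iff) auto
      then show ?thesis by (simp only: image_iff eq_commute[of 0] cong: bex_cong)
    qed
    then show ?thesis unfolding trace neg_equal_0_iff_equal w_0 using False by blast
  qed
qed

text \<open>\<open>T\<close> is the kernel of the trace map for an auxiliary \<open>G\<close>. The
  map has values in \<open>G\<close> and is -1 on \<open>G\<close>, so adding its trace to a vector
  gives a vector of \<open>T\<close>. Thus the space is the direct sum of \<open>T\<close> and
  \<open>G\<close>, which gives the dimension 3n - n.\<close>

lemma tangent_space:
  assumes E: "E \<in> \<O>"
  obtains T where "vec.subspace T" "E \<subseteq> T" "vec.dim T = 2 * n"
    "\<And>v. v \<notin> E \<Longrightarrow> v \<in> T \<longleftrightarrow> (\<forall>F\<in>\<O> - {E}. v \<notin> vec.span (E \<union> F))"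
proof -
  obtain G where G: "G \<in> \<O>" "G \<noteq> E" using avoid[of "{E}"] by auto
  let ?t = "trace_map E G"
  define T where "T = {v. ?t v = 0}"
  have add: "?t (u + v) = ?t u + ?t v" for u v
    unfolding trace_map_def using E G
    by (subst sum.distrib[symmetric]) (auto intro!: sum.cong component_add)
  have scale: "?t (c *s v) = c *s ?t v" for c v
    unfolding trace_map_def vec.scale_sum_right using E G
    by (auto intro!: sum.cong component_scale)
  have mem: "?t v \<in> G" for v
    unfolding trace_map_def using E G subspace
    by (auto intro!: vec.subspace_sum component_mem)
  have "?t 0 = 0" using scale[of 0 0] by simp
  then have T: "vec.subspace T"
    unfolding vec.subspace_def T_def by (simp add: add scale)
  have "component E F G v = 0" if "v \<in> E" "F \<in> \<O> - {E, G}" for v F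
    using that E G by (subst component_eq_0_iff) (auto simp: vec.span_base)
  then have ET: "E \<subseteq> T" by (auto simp: T_def trace_map_def)
  have iff: "v \<in> T \<longleftrightarrow> (\<forall>F\<in>\<O> - {E}. v \<notin> vec.span (E \<union> F))" if "v \<notin> E" for v
    unfolding T_def using trace_map_eq_0_iff that E G by auto
  have TG: "T \<inter> G = {0}"
  proof -
    have "v = 0" if "v \<in> T" "v \<in> G" for v
    proof (rule ccontr)
      assume "v \<noteq> 0"
      then have "v \<notin> E" using disjoint E G that by blast
      then show False using iff that E G vec.span_base by blast
    qed
    then show ?thesis using T vec.subspace_0 subspace[OF G(1)] by blast
  qed
  have "vec.dim T = 2 * n"
  proof -
    have neg: "?t g = - g" if "g \<in> G" for g
    proof -
      have "?t g = (\<Sum>F\<in>\<O> - {E, G}. g)"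
        unfolding trace_map_def using that E G by (intro sum.cong component_id) auto
      also have "\<dots> = - g" using E G by (intro sum_rest_const) auto
      finally show ?thesis .
    qed
    have "v \<in> {x + y |x y. x \<in> T \<and> y \<in> G}" for v
    proof -
      have "v + ?t v \<in> T" unfolding T_def by (simp add: add neg[OF mem])
      moreover have "- ?t v \<in> G" using mem subspace G vec.subspace_neg by blast
      moreover have "v = (v + ?t v) + - ?t v" by simp
      ultimately show ?thesis by blast
    qed
    then have "{x + y |x y. x \<in> T \<and> y \<in> G} = UNIV" by blast
    then have "3 * n + 0 = vec.dim T + n"
      using vec.dim_sums_Int[OF T subspace[OF G(1)]] by (simp add: TG dim_elem[OF G(1)] dim_space[symmetric] vec_dim_card del: vec.dim_UNIV)
    then show ?thesis by simp
  qed
  then show ?thesis using that[OF T ET _ iff] by blast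
qed

end

section \<open>Points and spreads of a quotient in terms of vectors\<close>

lemma is_quot_point_iff:
  fixes E :: "('a::field ^ 'd::finite) set"
  assumes E: "vec.subspace E"
  shows "is_quot_space E 1 P \<longleftrightarrow> (\<exists>v. v \<notin> E \<and> P = quot (vec.span (insert v E)) E)"
proof
  assume "is_quot_space E 1 P"
  then obtain U where U: "vec.subspace U" "E \<subseteq> U" "vec.dim U = vec.dim E + 1" "P = quot U E"
    unfolding is_quot_space_def by blast
  then obtain v where v: "v \<in> U" "v \<notin> E" by (metis add_cancel_right_right one_neq_zero subsetI subset_antisym)
  have "vec.dim (vec.span (insert v E)) = vec.dim U"
    using v U by (simp add: vec.dim_insert vec.span_eq_iff[THEN iffD2, OF E])
  moreover have "vec.span (insert v E) \<subseteq> U" using U v by (intro vec.span_minimal) auto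
  ultimately have "vec.span (insert v E) = U"
    using U by (intro vec.subspace_dim_equal) auto
  then show "\<exists>v. v \<notin> E \<and> P = quot (vec.span (insert v E)) E" using v U by blast
next
  assume "\<exists>v. v \<notin> E \<and> P = quot (vec.span (insert v E)) E"
  then obtain v where v: "v \<notin> E" "P = quot (vec.span (insert v E)) E" by blast
  have "vec.dim (vec.span (insert v E)) = vec.dim E + 1"
    using v by (simp add: vec.dim_insert vec.span_eq_iff[THEN iffD2, OF E])
  then show "is_quot_space E 1 P"
    unfolding is_quot_space_def using v
    by (intro exI[of _ "vec.span (insert v E)"]) (auto simp: vec.span_base)
qed

text \<open>Points of the quotient are replaced by vectors outside \<open>E\<close>: a point lies in
  the image of a subspace containing \<open>E\<close> iff a generating vector lies in that
  subspace.\<close>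

lemma is_quot_spread_iff:
  fixes E :: "('a::field ^ 'd::finite) set"
  assumes E: "vec.subspace E"
  shows "is_quot_spread E n S \<longleftrightarrow> (\<forall>W\<in>S. is_quot_space E n W) \<and>
    (\<forall>v. v \<notin> E \<longrightarrow> (\<exists>!W. W \<in> S \<and> v +o E \<in> W))"
proof (cases "\<forall>W\<in>S. is_quot_space E n W")
  case True
  have "quot (vec.span (insert v E)) E \<subseteq> W \<longleftrightarrow> v +o E \<in> W" if "W \<in> S" for v W
  proof -
    obtain U where U: "vec.subspace U" "E \<subseteq> U" "W = quot U E"
      using True \<open>W \<in> S\<close> unfolding is_quot_space_def by blast
    have "E \<subseteq> vec.span (insert v E)" by (auto simp: vec.span_base)
    then have "quot (vec.span (insert v E)) E \<subseteq> W \<longleftrightarrow> vec.span (insert v E) \<subseteq> U"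
      using quot_subset_iff[OF E vec.subspace_span _ U(1,2)] U(3) by simp
    also have "\<dots> \<longleftrightarrow> v \<in> U"
      using U by (meson insert_subset subset_trans vec.span_minimal vec.span_superset)
    finally show ?thesis using mem_quot[OF E U(1,2)] U(3) by simp
  qed
  then have eq: "(\<exists>!W. W \<in> S \<and> quot (vec.span (insert v E)) E \<subseteq> W) \<longleftrightarrow> (\<exists>!W. W \<in> S \<and> v +o E \<in> W)" for v
    by (simp cong: conj_cong)
  have "is_quot_spread E n S \<longleftrightarrow>
      (\<forall>v. v \<notin> E \<longrightarrow> (\<exists>!W. W \<in> S \<and> quot (vec.span (insert v E)) E \<subseteq> W))"
    (is "?L \<longleftrightarrow> ?R")
  proof
    assume ?L
    then show ?R unfolding is_quot_spread_def is_quot_point_iff[OF E] by blast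
  next
    assume R: ?R
    show ?L unfolding is_quot_spread_def is_quot_point_iff[OF E]
    proof (intro conjI allI impI)
      fix P assume "\<exists>v. v \<notin> E \<and> P = quot (vec.span (insert v E)) E"
      then obtain v where "v \<notin> E" "P = quot (vec.span (insert v E)) E" by blast
      then show "\<exists>!W. W \<in> S \<and> P \<subseteq> W" using R by simp
    qed (rule True)
  qed
  then show ?thesis unfolding eq using True by simp
qed (unfold is_quot_spread_def, blast)

context pseudo_oval_space
begin

lemma dim_join:
  assumes "E \<in> \<O>" "F \<in> \<O>" "E \<noteq> F"
  shows "vec.dim (vec.span (E \<union> F)) = 2 * n"
proof -
  have "E \<inter> F = {0}"
    using disjoint[OF assms] subspace assms vec.subspace_0 by blast
  moreover have "vec.span (E \<union> F) = {x + y |x y. x \<in> E \<and> y \<in> F}"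
    using assms by (simp add: vec.span_Un vec.span_eq_iff[THEN iffD2] subspace)
  ultimately show ?thesis
    using vec.dim_sums_Int[of E F] assms by (simp add: subspace dim_elem)
qed

text \<open>Makes the definite description in \<open>induced_spread\<close> meaningful. The tangent
  space covers exactly the vectors that the partial spread leaves over. Conversely, in any extension
  the member through a tangent vector cannot meet a join outside \<open>E\<close>, so it is the
  tangent space.\<close>

lemma ex1_induced_spread:
  assumes E: "E \<in> \<O>"
  shows "\<exists>!S. is_quot_spread E n S \<and> induced_partial_spread \<O> E \<subseteq> S"
proof -
  obtain T where T: "vec.subspace T" "E \<subseteq> T" "vec.dim T = 2 * n"
    and mem_T: "\<And>v. v \<notin> E \<Longrightarrow> v \<in> T \<longleftrightarrow> (\<forall>F\<in>\<O> - {E}. v \<notin> vec.span (E \<union> F))"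
    using tangent_space[OF E] by metis
  note sE = subspace[OF E]
  have sub: "E \<subseteq> vec.span (E \<union> F)" for F by (auto simp: vec.span_base)
  have mem_join: "v +o E \<in> quot (vec.span (E \<union> F)) E \<longleftrightarrow> v \<in> vec.span (E \<union> F)" for v F
    by (rule mem_quot[OF sE vec.subspace_span sub])
  have mem_tan: "v +o E \<in> quot T E \<longleftrightarrow> v \<in> T" for v
    by (rule mem_quot[OF sE T(1,2)])
  define S where "S = insert (quot T E) (induced_partial_spread \<O> E)"
  have space: "is_quot_space E n W" if "W \<in> S" for W
  proof -
    have "is_quot_space E n (quot T E)"
      unfolding is_quot_space_def using T dim_elem[OF E] by (intro exI[of _ T]) auto
    moreover have "is_quot_space E n (quot (vec.span (E \<union> F)) E)" if "F \<in> \<O>" "F \<noteq> E" for F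
      unfolding is_quot_space_def using that dim_join[OF E, of F] dim_elem[OF E] sub
      by (intro exI[of _ "vec.span (E \<union> F)"]) auto
    ultimately show ?thesis using that unfolding S_def induced_partial_spread_def by auto
  qed
  have S: "is_quot_spread E n S"
    unfolding is_quot_spread_iff[OF sE]
  proof (intro conjI ballI allI impI)
    fix v assume v: "v \<notin> E"
    show "\<exists>!W. W \<in> S \<and> v +o E \<in> W"
    proof (cases "v \<in> T")
      case True
      then have no: "v \<notin> vec.span (E \<union> F)" if "F \<in> \<O>" "F \<noteq> E" for F using mem_T v that by blast
      show ?thesis
      proof (rule ex1I[of _ "quot T E"])
        show "quot T E \<in> S \<and> v +o E \<in> quot T E" using True mem_tan S_def by simp
        fix W assume "W \<in> S \<and> v +o E \<in> W"
        then show "W = quot T E"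
          using no mem_join unfolding S_def induced_partial_spread_def by auto
      qed
    next
      case False
      then obtain F where F: "F \<in> \<O>" "F \<noteq> E" "v \<in> vec.span (E \<union> F)" using mem_T v by blast
      show ?thesis
      proof (rule ex1I[of _ "quot (vec.span (E \<union> F)) E"])
        show "quot (vec.span (E \<union> F)) E \<in> S \<and> v +o E \<in> quot (vec.span (E \<union> F)) E"
          using F mem_join unfolding S_def induced_partial_spread_def by auto
        fix W assume W: "W \<in> S \<and> v +o E \<in> W"
        then have "W \<noteq> quot T E" using False mem_tan by blast
        then obtain F' where F': "F' \<in> \<O>" "F' \<noteq> E" "W = quot (vec.span (E \<union> F')) E"
          using W unfolding S_def induced_partial_spread_def by auto
        then have "F' = F" using joins_meet[of E F F' v] E F W mem_join v by auto
        then show "W = quot (vec.span (E \<union> F)) E" using F' by simp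
      qed
    qed
  qed (rule space)
  show ?thesis
  proof (rule ex1I[of _ S])
    show "is_quot_spread E n S \<and> induced_partial_spread \<O> E \<subseteq> S"
      using S S_def by auto
  next
    fix S' assume S': "is_quot_spread E n S' \<and> induced_partial_spread \<O> E \<subseteq> S'"
    then have space': "\<And>W. W \<in> S' \<Longrightarrow> is_quot_space E n W"
      and uniq': "\<And>v. v \<notin> E \<Longrightarrow> \<exists>!W. W \<in> S' \<and> v +o E \<in> W"
      unfolding is_quot_spread_iff[OF sE] by blast+
    have not_sub: "\<exists>v\<in>U. v \<notin> E" if "vec.dim U = 2 * n" for U
    proof (rule ccontr)
      assume "\<not> (\<exists>v\<in>U. v \<notin> E)"
      then have "vec.dim U \<le> vec.dim E" by (intro vec.dim_subset) auto
      then show False using that dim_elem[OF E] n_gt_1 by simp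
    qed
    \<comment> \<open>The member of \<open>S'\<close> through a tangent vector will turn out to be
      \<open>quot T E\<close>.\<close>
    obtain v where v: "v \<in> T" "v \<notin> E" using not_sub T by blast
    then obtain W where W: "W \<in> S'" "v +o E \<in> W" using uniq' by blast
    then obtain U where U: "vec.subspace U" "E \<subseteq> U" "vec.dim U = 2 * n" "W = quot U E"
      using space' dim_elem[OF E] unfolding is_quot_space_def by fastforce
    have mem_U: "u +o E \<in> W \<longleftrightarrow> u \<in> U" for u using mem_quot[OF sE U(1,2)] U(4) by simp
    have "u \<in> T" if u: "u \<in> U" "u \<notin> E" for u
    proof (rule ccontr)
      assume "u \<notin> T"
      then obtain F where F: "F \<in> \<O>" "F \<noteq> E" "u \<in> vec.span (E \<union> F)" using mem_T u by blast
      then have "quot (vec.span (E \<union> F)) E \<in> S'" "u +o E \<in> quot (vec.span (E \<union> F)) E"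
        using S' mem_join unfolding induced_partial_spread_def by auto
      moreover have "u +o E \<in> W" using mem_U u by blast
      ultimately have "W = quot (vec.span (E \<union> F)) E" using uniq'[OF u(2)] W(1) by blast
      then have "v \<in> vec.span (E \<union> F)" using W(2) mem_join by blast
      then show False using mem_T v F by blast
    qed
    then have "U \<subseteq> T" using T(2) by blast
    then have "U = T" using U T by (intro vec.subspace_dim_equal) auto
    then have sub': "S \<subseteq> S'" using S' W U(4) unfolding S_def by auto
    \<comment> \<open>A member of \<open>S'\<close> contains a nonzero coset, which \<open>S\<close>
      covers as well. Uniqueness in \<open>S'\<close> makes the two members equal.\<close>
    show "S' = S"
    proof (rule subset_antisym[OF _ sub'], rule subsetI)
      fix W assume W: "W \<in> S'"
      then obtain U where U: "vec.subspace U" "E \<subseteq> U" "vec.dim U = 2 * n" "W = quot U E"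
        using space' dim_elem[OF E] unfolding is_quot_space_def by fastforce
      obtain v where v: "v \<in> U" "v \<notin> E" using not_sub U by blast
      then have "v +o E \<in> W" using mem_quot[OF sE U(1,2)] U(4) by simp
      moreover obtain W' where "W' \<in> S" "v +o E \<in> W'"
        using S v unfolding is_quot_spread_iff[OF sE] by blast
      ultimately have "W = W'" using uniq'[OF v(2)] W sub' by blast
      then show "W \<in> S" using \<open>W' \<in> S\<close> by simp
    qed
  qed
qed

text \<open>Besides the Desarguesian property, the only fact about \<open>induced_spread\<close>
  that enters later.\<close>

lemma induced_partial_spread_subset:
  "E \<in> \<O> \<Longrightarrow> induced_partial_spread \<O> E \<subseteq> induced_spread n \<O> E"
  using theI'[OF ex1_induced_spread] unfolding induced_spread_def by blast

end

section \<open>Extensions of prime degree\<close>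

text \<open>Here \<open>'k\<close> is a vector space over \<open>'a\<close> through \<iota>.\<close>

definition ext_functional :: "('a::field \<Rightarrow> 'k::field) \<Rightarrow> ('a ^ 'd \<Rightarrow> 'k) \<Rightarrow> bool" where
  "ext_functional \<iota> p \<longleftrightarrow> (\<forall>u v. p (u + v) = p u + p v) \<and> (\<forall>c v. p (c *s v) = \<iota> c * p v)"

text \<open>Such a bijection transports the multiplication of \<open>'k\<close> to a second field
  structure on the same \<open>'a\<close>-space.\<close>

definition ext_linear_bij :: "('a::field \<Rightarrow> 'k::field) \<Rightarrow> ('k \<Rightarrow> 'k) \<Rightarrow> bool" where
  "ext_linear_bij \<iota> \<theta> \<longleftrightarrow> bij \<theta> \<and> (\<forall>x y. \<theta> (x + y) = \<theta> x + \<theta> y) \<and> (\<forall>c x. \<theta> (\<iota> c * x) = \<iota> c * \<theta> x)"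

lemma additive_diff:
  fixes p :: "'b::ab_group_add \<Rightarrow> 'c::ab_group_add"
  assumes "\<And>u v. p (u + v) = p u + p v"
  shows "p (u - v) = p u - p v" and "p 0 = 0"
proof -
  show "p 0 = 0" using assms[of 0 0] by simp
  show "p (u - v) = p u - p v" using assms[of "u - v" v] by (simp add: algebra_simps)
qed

lemma ext_functional_diff: "ext_functional \<iota> p \<Longrightarrow> p (u - v) = p u - p v"
  and ext_functional_0: "ext_functional \<iota> p \<Longrightarrow> p 0 = 0"
  using additive_diff[of p] by (auto simp: ext_functional_def)

lemma ext_functional_add: "ext_functional \<iota> p \<Longrightarrow> p (u + v) = p u + p v"
  and ext_functional_scale: "ext_functional \<iota> p \<Longrightarrow> p (c *s v) = \<iota> c * p v"
  by (auto simp: ext_functional_def)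

text \<open>As the kernels agree, \<open>p'\<close> factors through \<open>p\<close>. This relates
  coordinates taken in the quotients by two different elements: both coordinates live on the
  quotient by the join of the two.\<close>

lemma ext_functional_comparison:
  fixes p p' :: "'a::field ^ 'd \<Rightarrow> 'k::{field,finite}"
  assumes p: "ext_functional \<iota> p" "surj p" and p': "ext_functional \<iota> p'"
    and ker: "\<And>v. p v = 0 \<longleftrightarrow> p' v = 0"
  obtains \<theta> where "ext_linear_bij \<iota> \<theta>" "\<And>v. p' v = \<theta> (p v)"
proof
  define \<theta> where "\<theta> x = p' (SOME v. p v = x)" for x
  have eq: "p' v = \<theta> (p v)" for v
  proof -
    have "p (SOME w. p w = p v) = p v" by (rule someI[of _ v]) simp
    then have "p (v - (SOME w. p w = p v)) = 0" using ext_functional_diff[OF p(1)] by simp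
    then have "p' (v - (SOME w. p w = p v)) = 0" using ker by simp
    then show ?thesis unfolding \<theta>_def using ext_functional_diff[OF p'] by simp
  qed
  then show "p' v = \<theta> (p v)" for v .
  have add: "\<theta> (x + y) = \<theta> x + \<theta> y" for x y
    using eq[symmetric] surjD[OF p(2), of x] surjD[OF p(2), of y]
    by (auto simp: ext_functional_add[OF p(1), symmetric] ext_functional_add[OF p'])
  have scale: "\<theta> (\<iota> c * x) = \<iota> c * \<theta> x" for c x
    using eq[symmetric] surjD[OF p(2), of x]
    by (auto simp: ext_functional_scale[OF p(1), symmetric] ext_functional_scale[OF p'])
  have "inj \<theta>"
  proof (rule injI)
    fix x y assume "\<theta> x = \<theta> y"
    then have "\<theta> (x - y) = 0" using additive_diff(1)[of \<theta>] add by simp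
    moreover obtain v where "x - y = p v" using surjD[OF p(2)] by blast
    ultimately show "x = y" using eq ker by (metis eq_iff_diff_eq_0)
  qed
  then have "bij \<theta>" by (simp add: bij_def finite_UNIV_inj_surj)
  then show "ext_linear_bij \<iota> \<theta>" unfolding ext_linear_bij_def using add scale by blast
qed

section \<open>Subfields between GF(q) and GF(q^n)\<close>

definition is_subfield :: "'k::field set \<Rightarrow> bool" where
  "is_subfield F \<longleftrightarrow> 1 \<in> F \<and> (\<forall>x\<in>F. \<forall>y\<in>F. x - y \<in> F) \<and> (\<forall>x\<in>F. \<forall>y\<in>F. x * y \<in> F) \<and>
     (\<forall>x\<in>F. inverse x \<in> F)"

definition is_submodule :: "'k::field set \<Rightarrow> 'k set \<Rightarrow> bool" where
  "is_submodule F U \<longleftrightarrow> 0 \<in> U \<and> (\<forall>x\<in>U. \<forall>y\<in>U. x - y \<in> U) \<and> (\<forall>c\<in>F. \<forall>x\<in>U. c * x \<in> U)"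

lemma submodule_add:
  assumes "is_submodule F U" "x \<in> U" "y \<in> U"
  shows "x + y \<in> U"
proof -
  have "0 - y \<in> U" using assms unfolding is_submodule_def by blast
  then have "x - (0 - y) \<in> U" using assms unfolding is_submodule_def by blast
  then show ?thesis by simp
qed

text \<open>An \<open>x\<close> in \<open>U\<close> outside \<open>W\<close> enlarges
  \<open>W\<close> to W + F x, which has |F| times as many elements; this is repeated until
  \<open>U\<close> is reached. \<open>F\<close> is a set and not a type because it will be a
  subfield determined by a map.\<close>

lemma card_submodule_chain:
  fixes U :: "'k::{field,finite} set"
  assumes F: "is_subfield F" and U: "is_submodule F U"
    and "is_submodule F W" "W \<subseteq> U" "card W = card F ^ i"
  shows "\<exists>d. card U = card F ^ d"
  using assms(3-5)
proof (induction "card (U - W)" arbitrary: W i rule: less_induct)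
  case less
  note W = less.prems
  show ?case
  proof (cases "W = U")
    case False
    then obtain x where x: "x \<in> U" "x \<notin> W" using W by blast
    let ?f = "\<lambda>(w, c). w + c * x"
    define W' where "W' = ?f ` (W \<times> F)"
    have F0: "0 \<in> F" using F unfolding is_subfield_def by (metis diff_self)
    have sub: "W' \<subseteq> U"
    proof
      fix z assume "z \<in> W'"
      then obtain w c where wc: "w \<in> W" "c \<in> F" "z = w + c * x" unfolding W'_def by auto
      then have "c * x \<in> U" "w \<in> U" using U x W unfolding is_submodule_def by blast+
      then show "z \<in> U" using submodule_add[OF U] wc by simp
    qed
    have "W \<subseteq> W'"
    proof
      fix w assume "w \<in> W"
      then show "w \<in> W'" unfolding W'_def using F0 by (intro image_eqI[of _ _ "(w, 0)"]) auto
    qed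
    moreover have "x \<in> W'"
      unfolding W'_def using F W(1)
      by (intro image_eqI[of _ _ "(0, 1)"]) (auto simp: is_subfield_def is_submodule_def)
    ultimately have "U - W' \<subset> U - W" using x sub by blast
    then have decr: "card (U - W') < card (U - W)" by (intro psubset_card_mono) auto
    have mod: "is_submodule F W'"
      unfolding is_submodule_def
    proof (intro conjI ballI)
      show "0 \<in> W'" using \<open>W \<subseteq> W'\<close> W(1) unfolding is_submodule_def by blast
    next
      fix y z assume "y \<in> W'" "z \<in> W'"
      then obtain v c w d where *: "v \<in> W" "c \<in> F" "y = v + c * x" "w \<in> W" "d \<in> F" "z = w + d * x"
        unfolding W'_def by auto
      then have "v - w \<in> W" "c - d \<in> F" using W(1) F unfolding is_submodule_def is_subfield_def by blast+
      moreover have "y - z = (v - w) + (c - d) * x" using * by (simp add: algebra_simps)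
      ultimately show "y - z \<in> W'" unfolding W'_def by (intro image_eqI[of _ _ "(v - w, c - d)"]) auto
    next
      fix d y assume "d \<in> F" "y \<in> W'"
      then obtain v c where *: "v \<in> W" "c \<in> F" "y = v + c * x"
        unfolding W'_def by auto
      then have "d * v \<in> W" "d * c \<in> F"
        using W(1) F \<open>d \<in> F\<close> unfolding is_submodule_def is_subfield_def by blast+
      moreover have "d * y = d * v + (d * c) * x" using * by (simp add: algebra_simps)
      ultimately show "d * y \<in> W'" unfolding W'_def by (intro image_eqI[of _ _ "(d * v, d * c)"]) auto
    qed
    have "inj_on ?f (W \<times> F)"
    proof (rule inj_onI)
      fix p p' assume "p \<in> W \<times> F" "p' \<in> W \<times> F" and eq: "?f p = ?f p'"
      then obtain v c w d where *: "p = (v, c)" "p' = (w, d)" "v \<in> W" "c \<in> F" "w \<in> W" "d \<in> F"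
        by auto
      have eq': "(c - d) * x = w - v" using eq * by (simp add: algebra_simps)
      \<comment> \<open>Otherwise division by c - d would put \<open>x\<close> into
        \<open>W\<close>.\<close>
      have "c = d"
      proof (rule ccontr)
        assume "c \<noteq> d"
        then have "x = inverse (c - d) * (w - v)" unfolding eq'[symmetric] by simp
        moreover have "inverse (c - d) \<in> F" using F * unfolding is_subfield_def by blast
        moreover have "w - v \<in> W" using W(1) * unfolding is_submodule_def by blast
        ultimately have "x \<in> W" using W(1) unfolding is_submodule_def by blast
        then show False using x by blast
      qed
      then show "p = p'" using * eq' by simp
    qed
    then have "card W' = card F ^ Suc i"
      unfolding W'_def using W(3) by (simp add: card_image card_cartesian_product)
    then show ?thesis using less.hyps[OF decr mod sub] by blast
  qed (use W in blast)
qed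

lemma card_submodule:
  fixes U :: "'k::{field,finite} set"
  assumes "is_subfield F" "is_submodule F U"
  shows "\<exists>d. card U = card F ^ d"
proof (rule card_submodule_chain[OF assms])
  show "is_submodule F {0}" by (simp add: is_submodule_def)
  show "{0} \<subseteq> U" using assms(2) by (simp add: is_submodule_def)
  show "card {0} = card F ^ 0" by simp
qed

locale prime_degree_extension =
  fixes \<iota> :: "'a::{field,finite} \<Rightarrow> 'k::{field,finite}" and n :: nat
  assumes embedding: "field_embedding \<iota>"
    and card_ext: "CARD('k) = CARD('a) ^ n"
    and prime_n: "prime n"
begin

lemma \<iota>_add: "\<iota> (x + y) = \<iota> x + \<iota> y"
  and \<iota>_mult: "\<iota> (x * y) = \<iota> x * \<iota> y"
  and \<iota>_1: "\<iota> 1 = 1"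
  using embedding by (auto simp: field_embedding_def)

lemma \<iota>_0: "\<iota> 0 = 0" and \<iota>_diff: "\<iota> (x - y) = \<iota> x - \<iota> y"
  using additive_diff[of \<iota>, OF \<iota>_add] by auto

lemma \<iota>_inverse: "\<iota> (inverse x) = inverse (\<iota> x)"
proof (cases "x = 0")
  case False
  then have "\<iota> x * \<iota> (inverse x) = 1" by (simp add: \<iota>_mult[symmetric] \<iota>_1)
  then show ?thesis by (rule inverse_unique[symmetric])
qed (simp add: \<iota>_0)

lemma \<iota>_divide: "\<iota> (x / y) = \<iota> x / \<iota> y"
  by (simp add: divide_inverse \<iota>_mult \<iota>_inverse)

lemma \<iota>_eq_0_iff: "\<iota> x = 0 \<longleftrightarrow> x = 0"
proof
  assume "\<iota> x = 0"
  show "x = 0"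
  proof (rule ccontr)
    assume "x \<noteq> 0"
    then have "\<iota> x * \<iota> (inverse x) = 1" by (simp add: \<iota>_mult[symmetric] \<iota>_1)
    then show False using \<open>\<iota> x = 0\<close> by simp
  qed
qed (simp add: \<iota>_0)

lemma inj_\<iota>: "inj \<iota>"
proof (rule injI)
  fix x y assume "\<iota> x = \<iota> y"
  then have "\<iota> (x - y) = 0" by (simp add: \<iota>_diff)
  then show "x = y" by (simp add: \<iota>_eq_0_iff)
qed

lemma card_range: "card (range \<iota>) = CARD('a)"
  by (simp add: card_image inj_\<iota>)

lemma subfield_range: "is_subfield (range \<iota>)"
  unfolding is_subfield_def
  by (auto simp: \<iota>_diff[symmetric] \<iota>_mult[symmetric] \<iota>_inverse[symmetric] intro: range_eqI[of _ _ 1] \<iota>_1[symmetric])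

text \<open>From |J| = q^d and q^n = |J|^m follows n = d m, and n is prime.\<close>

lemma no_intermediate_field:
  assumes J: "is_subfield J" "range \<iota> \<subseteq> J"
  shows "J = range \<iota> \<or> J = UNIV"
proof -
  have "0 \<in> J" using J(1) unfolding is_subfield_def by (metis diff_self)
  then have "is_submodule (range \<iota>) J" "is_submodule J UNIV"
    using J unfolding is_submodule_def is_subfield_def by blast+
  then obtain d m where d: "card J = CARD('a) ^ d" and m: "CARD('k) = card J ^ m"
    using card_submodule[OF subfield_range] card_submodule[OF J(1)] card_range by metis
  have "CARD('a) > 1"
  proof -
    have "card {0 :: 'a, 1} \<le> CARD('a)" by (intro card_mono) auto
    then show ?thesis by simp
  qed
  moreover have "CARD('a) ^ n = CARD('a) ^ (d * m)" using d m card_ext by (simp add: power_mult)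
  ultimately have "n = d * m" by (metis power_inject_exp)
  then have "d = 1 \<or> d = n" using prime_n by (metis dvd_triv_left prime_nat_iff)
  then show ?thesis
  proof
    assume "d = 1"
    then have "range \<iota> = J" using J d card_range by (intro card_subset_eq) auto
    then show ?thesis by simp
  next
    assume "d = n"
    then have "J = UNIV" using d card_ext by (intro card_subset_eq) auto
    then show ?thesis by simp
  qed
qed

section \<open>Operators common to two field structures\<close>

definition multipliers :: "('k \<Rightarrow> 'k) \<Rightarrow> 'k set" where
  "multipliers \<psi> = {b. \<exists>c. \<forall>y. \<psi> (b * y) = c * \<psi> y}"

lemma multipliersI: "(\<And>y. \<psi> (b * y) = c * \<psi> y) \<Longrightarrow> b \<in> multipliers \<psi>"
  unfolding multipliers_def by blast

context
  fixes \<psi> assumes \<psi>: "ext_linear_bij \<iota> \<psi>"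
begin

lemma ext_linear_bij_add: "\<psi> (x + y) = \<psi> x + \<psi> y"
  and ext_linear_bij_scale: "\<psi> (\<iota> c * x) = \<iota> c * \<psi> x"
  and ext_linear_bij_diff: "\<psi> (x - y) = \<psi> x - \<psi> y"
  and ext_linear_bij_0: "\<psi> 0 = 0"
  using \<psi> additive_diff[of \<psi>] unfolding ext_linear_bij_def by auto

lemma ext_linear_bij_inject: "\<psi> x = \<psi> y \<longleftrightarrow> x = y"
  and ext_linear_bij_inv: "\<psi> (inv \<psi> x) = x" "inv \<psi> (\<psi> x) = x"
  using \<psi> unfolding ext_linear_bij_def bij_def by (auto simp: inj_eq surj_f_inv_f)

lemma ext_linear_bij_eq_0_iff: "\<psi> x = 0 \<longleftrightarrow> x = 0"
  using ext_linear_bij_inject[of x 0] ext_linear_bij_0 by simp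

lemma ext_linear_bij_inv_bij: "ext_linear_bij \<iota> (inv \<psi>)"
proof -
  have "inv \<psi> (x + y) = inv \<psi> x + inv \<psi> y" for x y
    using ext_linear_bij_inv(2)[of "inv \<psi> x + inv \<psi> y"] by (simp add: ext_linear_bij_add ext_linear_bij_inv(1))
  moreover have "inv \<psi> (\<iota> c * x) = \<iota> c * inv \<psi> x" for c x
    using ext_linear_bij_inv(2)[of "\<iota> c * inv \<psi> x"] by (simp add: ext_linear_bij_scale ext_linear_bij_inv(1))
  moreover have "bij (inv \<psi>)" using \<psi> unfolding ext_linear_bij_def by (simp add: bij_imp_bij_inv)
  ultimately show ?thesis unfolding ext_linear_bij_def by blast
qed

text \<open>Multiplication by a multiplier stays a multiplication after transport along \<psi>. So
  the multipliers form the intersection of two copies of \<open>'k\<close>, a field that contains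
  GF(q), and the prime degree leaves two cases.\<close>

lemma multipliers_cases: "multipliers \<psi> = range \<iota> \<or> multipliers \<psi> = UNIV"
proof (rule no_intermediate_field)
  show "range \<iota> \<subseteq> multipliers \<psi>"
    using ext_linear_bij_scale multipliersI by blast
  show "is_subfield (multipliers \<psi>)"
    unfolding is_subfield_def
  proof (intro conjI ballI)
    show "1 \<in> multipliers \<psi>" by (rule multipliersI[of _ _ 1]) simp
  next
    fix b b' assume "b \<in> multipliers \<psi>" "b' \<in> multipliers \<psi>"
    then obtain c c' where *: "\<And>y. \<psi> (b * y) = c * \<psi> y" "\<And>y. \<psi> (b' * y) = c' * \<psi> y"
      unfolding multipliers_def by blast
    show "b - b' \<in> multipliers \<psi>"
      by (rule multipliersI[of _ _ "c - c'"]) (simp add: left_diff_distrib ext_linear_bij_diff *)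
    show "b * b' \<in> multipliers \<psi>"
      by (rule multipliersI[of _ _ "c * c'"]) (simp add: mult.assoc *)
  next
    fix b assume b: "b \<in> multipliers \<psi>"
    then obtain c where *: "\<And>y. \<psi> (b * y) = c * \<psi> y" unfolding multipliers_def by blast
    show "inverse b \<in> multipliers \<psi>"
    proof (cases "b = 0")
      case False
      have "c \<noteq> 0"
      proof
        assume "c = 0"
        then have "\<psi> (b * 1) = 0" using *[of 1] by simp
        then show False using False ext_linear_bij_eq_0_iff by simp
      qed
      have "\<psi> (inverse b * y) = inverse c * \<psi> y" for y
        using *[of "inverse b * y"] False \<open>c \<noteq> 0\<close> by (simp add: mult.assoc[symmetric])
      then show ?thesis by (rule multipliersI)
    qed (use b in simp)
  qed
qed

text \<open>By definition every multiplier has a factor; conversely, here every factor comes from a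
  multiplier. Evaluation at 1 dictates the choice of \<open>b\<close>.\<close>

lemma multiplier_ex:
  assumes "multipliers \<psi> = UNIV"
  obtains b where "\<And>y. \<psi> (b * y) = c * \<psi> y"
proof
  define b where "b = inv \<psi> (c * \<psi> 1)"
  have "b \<in> multipliers \<psi>" using assms by simp
  then obtain c' where *: "\<And>y. \<psi> (b * y) = c' * \<psi> y" unfolding multipliers_def by blast
  have "c' * \<psi> 1 = \<psi> b" using *[of 1] by simp
  also have "\<dots> = c * \<psi> 1" by (simp add: b_def ext_linear_bij_inv)
  finally have "c' * \<psi> 1 = c * \<psi> 1" .
  moreover have "\<psi> 1 \<noteq> 0" by (simp add: ext_linear_bij_eq_0_iff)
  ultimately have "c' = c" by simp
  then show "\<psi> (b * y) = c * \<psi> y" for y using * by simp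
qed

end

lemma ext_linear_bij_comp: "ext_linear_bij \<iota> \<psi> \<Longrightarrow> ext_linear_bij \<iota> \<psi>' \<Longrightarrow> ext_linear_bij \<iota> (\<lambda>x. \<psi> (\<psi>' x))"
  unfolding ext_linear_bij_def using bij_comp[of \<psi>' \<psi>] by (simp add: comp_def)

text \<open>The action of \<open>b\<close> in the field structure pulled back along \<theta>. Plain
  multiplications form the field \<open>K\<^sub>1\<close>, these maps form
  \<open>K\<^sub>2\<close>.\<close>

definition conj_mult :: "('k \<Rightarrow> 'k) \<Rightarrow> 'k \<Rightarrow> 'k \<Rightarrow> 'k" where
  "conj_mult \<theta> b x = inv \<theta> (b * \<theta> x)"

context
  fixes \<theta> assumes \<theta>: "ext_linear_bij \<iota> \<theta>" and mult_\<theta>: "multipliers \<theta> = range \<iota>"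
begin

text \<open>An operator in both structures makes \<open>a\<close> a multiplier of \<theta>, hence a
  scalar; evaluation at 1 shows that \<open>b\<close> is the same scalar.\<close>

lemma conj_mult_eq_mult:
  assumes "\<And>x. conj_mult \<theta> b x = a * x"
  shows "a \<in> range \<iota>" and "b \<in> range \<iota>"
proof -
  have *: "\<theta> (a * x) = b * \<theta> x" for x
    unfolding assms[symmetric] conj_mult_def by (simp add: ext_linear_bij_inv[OF \<theta>])
  then show a: "a \<in> range \<iota>" using multipliersI[of \<theta>] mult_\<theta> by blast
  then obtain s where "a = \<iota> s" by blast
  have "b * \<theta> 1 = \<theta> (a * 1)" by (rule *[symmetric])
  also have "\<dots> = \<iota> s * \<theta> 1" unfolding \<open>a = \<iota> s\<close> by (rule ext_linear_bij_scale[OF \<theta>])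
  finally have "b * \<theta> 1 = \<iota> s * \<theta> 1" .
  moreover have "\<theta> 1 \<noteq> 0" by (simp add: ext_linear_bij_eq_0_iff[OF \<theta>])
  ultimately have "b = \<iota> s" by simp
  then show "b \<in> range \<iota>" by blast
qed

text \<open>The factors \<open>c\<close> and \<open>c'\<close> act through \<eta> as operators of
  \<open>K\<^sub>3\<close>, so \<open>scalar\<close> puts the operator of \<open>b\<close> into
  \<open>K\<^sub>2\<close> and \<open>K\<^sub>3\<close>. If these fields were equal,
  \<open>a'\<close>, a quotient of operators from them, would lie in \<open>K\<^sub>1\<close> and
  \<open>K\<^sub>2\<close>, hence in GF(q).\<close>

lemma scalar_to_scalar:
  assumes \<eta>: "ext_linear_bij \<iota> \<eta>"
    and scalar: "\<And>x. c * \<eta> (\<iota> t * x) = \<eta> (conj_mult \<theta> b x)"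
    and other: "\<And>x. c' * \<eta> (a' * x) = \<eta> (conj_mult \<theta> b' x)" "a' \<notin> range \<iota>" "b' \<noteq> 0"
  shows "b \<in> range \<iota>"
proof -
  let ?\<psi> = "\<lambda>x. \<eta> (inv \<theta> x)"
  have \<psi>: "ext_linear_bij \<iota> ?\<psi>"
    by (rule ext_linear_bij_comp[OF \<eta> ext_linear_bij_inv_bij[OF \<theta>]])
  have conj: "\<eta> (conj_mult \<theta> e x) = ?\<psi> (e * \<theta> x)" for e x by (simp add: conj_mult_def)
  have "?\<psi> (b * y) = (c * \<iota> t) * ?\<psi> y" for y
    using scalar[of "inv \<theta> y"]
    by (simp add: conj ext_linear_bij_inv[OF \<theta>] ext_linear_bij_scale[OF \<eta>] mult.assoc)
  then have "b \<in> multipliers ?\<psi>" by (rule multipliersI)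
  moreover have "multipliers ?\<psi> \<noteq> UNIV"
  proof
    assume univ: "multipliers ?\<psi> = UNIV"
    then have "b' \<in> multipliers ?\<psi>" by simp
    then obtain d where d: "\<And>y. ?\<psi> (b' * y) = d * ?\<psi> y" unfolding multipliers_def by blast
    have c': "c' \<noteq> 0"
    proof
      assume "c' = 0"
      then have "?\<psi> (b' * \<theta> 1) = 0" using other(1)[of 1] by (simp add: conj)
      then show False
        using ext_linear_bij_eq_0_iff[OF \<psi>] ext_linear_bij_eq_0_iff[OF \<theta>, of 1] other(3) by simp
    qed
    \<comment> \<open>The operator of \<open>b'\<close> has the factor \<open>d\<close> under
      \<eta>. Dividing by \<open>c'\<close> leaves that of \<open>a'\<close>, which \<open>e\<close>
      represents in \<open>K\<^sub>2\<close>.\<close>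
    obtain e where e: "\<And>y. ?\<psi> (e * y) = (d / c') * ?\<psi> y" using multiplier_ex[OF \<psi> univ] by blast
    have "conj_mult \<theta> e x = a' * x" for x
    proof -
      have "c' * \<eta> (a' * x) = d * \<eta> x"
        unfolding other(1) conj d by (simp add: ext_linear_bij_inv[OF \<theta>])
      moreover have "\<eta> (conj_mult \<theta> e x) = (d / c') * \<eta> x"
        unfolding conj e by (simp add: ext_linear_bij_inv[OF \<theta>])
      ultimately have "c' * \<eta> (conj_mult \<theta> e x) = c' * \<eta> (a' * x)" using c' by simp
      then have "\<eta> (conj_mult \<theta> e x) = \<eta> (a' * x)" using c' by simp
      then show ?thesis by (simp add: ext_linear_bij_inject[OF \<eta>])
    qed
    then show False using conj_mult_eq_mult(1) other(2) by blast
  qed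
  ultimately show ?thesis using multipliers_cases[OF \<psi>] by blast
qed

text \<open>The two relations combine to the linear relation \<open>key\<close> between \<eta> (a x)
  and \<eta> x. If its left coefficient is nonzero, \<open>K\<^sub>1\<close> and
  \<open>K\<^sub>3\<close> share \<open>a\<close>, hence coincide, and the operator of
  \<open>b\<close> falls into \<open>K\<^sub>1\<close>. If it is zero, \<open>c\<close> is a scalar
  and the operators of \<open>a\<close> and \<open>b\<close> are proportional over GF(q). Either way
  \<open>K\<^sub>1\<close> and \<open>K\<^sub>2\<close> share an operator outside GF(q).\<close>

lemma affine_line_contradiction:
  assumes \<eta>: "ext_linear_bij \<iota> \<eta>"
    and ab: "\<And>x. c * \<eta> (a * x) = \<eta> (conj_mult \<theta> b x)" "a \<notin> range \<iota>" "b \<notin> range \<iota>"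
    and ab1: "\<And>x. c1 * \<eta> ((1 + \<iota> t * (a - 1)) * x) = \<eta> (conj_mult \<theta> (1 + \<iota> g * (b - 1)) x)"
    and tg: "t \<noteq> 1" "g \<noteq> 0"
  shows False
proof -
  have conj1: "conj_mult \<theta> (1 + \<iota> g * (b - 1)) x = x + \<iota> g * (conj_mult \<theta> b x - x)" for x
  proof -
    have "(1 + \<iota> g * (b - 1)) * \<theta> x = \<theta> x + \<iota> g * (b * \<theta> x - \<theta> x)" by (simp add: algebra_simps)
    then show ?thesis
      using ext_linear_bij_inv_bij[OF \<theta>]
      by (simp add: conj_mult_def ext_linear_bij_add ext_linear_bij_diff ext_linear_bij_scale
          ext_linear_bij_inv[OF \<theta>])
  qed
  have key: "(c1 * \<iota> t - \<iota> g * c) * \<eta> (a * x) = ((1 - \<iota> g) - c1 * (1 - \<iota> t)) * \<eta> x" for x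
  proof -
    have "(1 + \<iota> t * (a - 1)) * x = x + \<iota> t * (a * x - x)" by (simp add: algebra_simps)
    then have "c1 * (\<eta> x + \<iota> t * (\<eta> (a * x) - \<eta> x)) = \<eta> x + \<iota> g * (c * \<eta> (a * x) - \<eta> x)"
      using ab1[of x] unfolding conj1
      by (simp add: ext_linear_bij_add[OF \<eta>] ext_linear_bij_diff[OF \<eta>] ext_linear_bij_scale[OF \<eta>] ab(1))
    then show ?thesis by (simp add: algebra_simps)
  qed
  have \<eta>1: "\<eta> 1 \<noteq> 0" using ext_linear_bij_eq_0_iff[OF \<eta>] by simp
  show False
  proof (cases "c1 * \<iota> t = \<iota> g * c")
    case False
    have "\<eta> (a * x) = (((1 - \<iota> g) - c1 * (1 - \<iota> t)) / (c1 * \<iota> t - \<iota> g * c)) * \<eta> x" (is "_ = ?d * _") for x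
      using key[of x] False by (simp add: field_simps)
    then have a: "\<And>x. \<eta> (a * x) = ?d * \<eta> x" "a \<in> multipliers \<eta>" using multipliersI by blast+
    then have "multipliers \<eta> = UNIV" using multipliers_cases[OF \<eta>] ab(2) by blast
    \<comment> \<open>Now every factor under \<eta> is a multiplication, in particular the factor by
      which \<open>b\<close> acts.\<close>
    then obtain a' where "\<And>x. \<eta> (a' * x) = (c * ?d) * \<eta> x" using multiplier_ex[OF \<eta>] by blast
    then have "\<eta> (conj_mult \<theta> b x) = \<eta> (a' * x)" for x
      unfolding ab(1)[symmetric] a(1) by simp
    then have "conj_mult \<theta> b x = a' * x" for x by (simp add: ext_linear_bij_inject[OF \<eta>])
    then show False using conj_mult_eq_mult(2) ab(3) by blast
  next
    case True
    \<comment> \<open>Both sides of \<open>key\<close> vanish; \<open>t \<noteq> 1\<close> and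
      \<open>g \<noteq> 0\<close> allow solving for \<open>c1\<close> and then \<open>c\<close>
      inside GF(q).\<close>
    then have "(1 - \<iota> g) - c1 * (1 - \<iota> t) = 0" using key[of 1] \<eta>1 by simp
    moreover have t: "\<iota> t \<noteq> 1" using tg(1) inj_\<iota> \<iota>_1 by (metis injD)
    ultimately have "c1 = \<iota> ((1 - g) / (1 - t))"
      by (simp add: \<iota>_divide \<iota>_diff \<iota>_1 field_simps)
    moreover have "c = c1 * \<iota> t / \<iota> g" using True tg(2) by (simp add: \<iota>_eq_0_iff)
    ultimately obtain s where s: "c = \<iota> s" by (metis \<iota>_divide \<iota>_mult)
    have conj: "conj_mult \<theta> b x = (\<iota> s * a) * x" for x
    proof -
      have "\<eta> (conj_mult \<theta> b x) = \<eta> (\<iota> s * (a * x))"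
        unfolding ab(1)[symmetric] ext_linear_bij_scale[OF \<eta>] s by simp
      then show ?thesis by (simp add: ext_linear_bij_inject[OF \<eta>] mult.assoc)
    qed
    then obtain r where r: "\<iota> s * a = \<iota> r" using conj_mult_eq_mult(1) by blast
    have "s \<noteq> 0"
    proof
      assume "s = 0"
      then have "conj_mult \<theta> b 1 = 0" using conj[of 1] by (simp add: \<iota>_0)
      then have "b * \<theta> 1 = 0"
        using ext_linear_bij_eq_0_iff[OF ext_linear_bij_inv_bij[OF \<theta>]] by (simp add: conj_mult_def)
      then have "b = \<iota> 0" using ext_linear_bij_eq_0_iff[OF \<theta>, of 1] by (simp add: \<iota>_0)
      then show False using ab(3) by blast
    qed
    then have "a = \<iota> (r / s)" using r by (simp add: \<iota>_divide \<iota>_eq_0_iff field_simps)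
    then show False using ab(2) by blast
  qed
qed

end
end

section \<open>Functionals with values in the extension field\<close>

text \<open>The 2 by 2 determinant: for fixed nonzero \<open>w\<close> a functional that vanishes
  exactly on the point spanned by \<open>w\<close>.\<close>

definition area :: "'k::field ^ 2 \<Rightarrow> 'k ^ 2 \<Rightarrow> 'k" where
  "area u w = u $ 1 * w $ 2 - u $ 2 * w $ 1"

lemma area_add: "area (u + v) w = area u w + area v w"
  and area_scale: "area (c *s u) w = c * area u w"
  by (auto simp: area_def algebra_simps)

lemma area_eq_0_iff:
  assumes "w \<noteq> 0"
  shows "area u w = 0 \<longleftrightarrow> (\<exists>c. u = c *s w)"
proof
  assume *: "area u w = 0"
  consider "w $ 1 \<noteq> 0" | "w $ 2 \<noteq> 0" using assms by (auto simp: vec_eq_iff forall_2)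
  then show "\<exists>c. u = c *s w"
  proof cases
    case 1
    then have "u = (u $ 1 / w $ 1) *s w" using * by (auto simp: vec_eq_iff forall_2 area_def field_simps)
    then show ?thesis by blast
  next
    case 2
    then have "u = (u $ 2 / w $ 2) *s w" using * by (auto simp: vec_eq_iff forall_2 area_def field_simps)
    then show ?thesis by blast
  qed
qed (auto simp: area_def)

lemma is_space_1_iff: "is_space 1 P \<longleftrightarrow> (\<exists>m. m \<noteq> 0 \<and> P = range (\<lambda>c. c *s m))"
proof
  assume P: "is_space 1 P"
  obtain B where B: "B \<subseteq> P" "vec.independent B" "P \<subseteq> vec.span B" "card B = vec.dim P"
    using vec.basis_exists by blast
  then obtain m where m: "B = {m}" using P by (auto simp: is_space_def card_1_singleton_iff)
  have "m \<noteq> 0" using B(2) m vec.dependent_zero by blast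
  moreover have "vec.span {m} = P"
    using B m P by (intro subset_antisym vec.span_minimal) (auto simp: is_space_def)
  ultimately show "\<exists>m. m \<noteq> 0 \<and> P = range (\<lambda>c. c *s m)"
    by (auto simp: vec.span_singleton)
next
  assume "\<exists>m. m \<noteq> 0 \<and> P = range (\<lambda>c. c *s m)"
  then obtain m where "m \<noteq> 0" "P = vec.span {m}" by (auto simp: vec.span_singleton)
  then show "is_space 1 P" by (simp add: is_space_def)
qed

section \<open>Coordinates on the quotient by an element\<close>

locale desarguesian_oval = pseudo_oval_space n \<O> + prime_degree_extension \<iota> n
  for n and \<O> :: "('a::{field,finite} ^ 'd::finite) set set" and \<iota> :: "'a \<Rightarrow> 'k::{field,finite}" +
  assumes desarguesian: "\<And>E. E \<in> \<O> \<Longrightarrow> desarguesian_quot_spread \<iota> E (induced_spread n \<O> E)"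
begin

text \<open>The quotient map is followed by the inverse of the isomorphism \<phi>. The join of
  \<open>E\<close> and \<open>F\<close> gives a member of the Desarguesian spread, so it comes from
  a point of K^2, and \<open>F\<close> represents all its cosets.\<close>

lemma projection:
  assumes E: "E \<in> \<O>"
  obtains \<pi> :: "'a ^ 'd \<Rightarrow> 'k ^ 2" where
    "\<And>u v. \<pi> (u + v) = \<pi> u + \<pi> v" "\<And>c v. \<pi> (c *s v) = \<iota> c *s \<pi> v"
    "\<And>v. \<pi> v = 0 \<longleftrightarrow> v \<in> E"
    "\<And>F. F \<in> \<O> \<Longrightarrow> F \<noteq> E \<Longrightarrow> \<exists>m. m \<noteq> 0 \<and> \<pi> ` F = range (\<lambda>c. c *s m)"
proof -
  note sE = subspace[OF E]
  obtain \<phi> :: "'k ^ 2 \<Rightarrow> ('a ^ 'd) set" where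
    bij: "bij_betw \<phi> UNIV (quot UNIV E)" and add: "\<And>x y. \<phi> (x + y) = \<phi> x + \<phi> y"
    and scale: "\<And>c x. \<phi> (\<iota> c *s x) = quot_scale E c (\<phi> x)"
    and spread: "induced_spread n \<O> E = field_reduction \<phi> {P. is_space 1 P}"
    using desarguesian[OF E] unfolding desarguesian_quot_spread_def reduction_iso_def by blast
  have inj: "\<phi> x = \<phi> y \<longleftrightarrow> x = y" for x y
    using bij by (auto simp: bij_betw_def inj_eq)
  define \<pi> where "\<pi> v = inv \<phi> (v +o E)" for v
  have \<pi>: "\<phi> (\<pi> v) = v +o E" for v
    unfolding \<pi>_def using bij by (intro f_inv_into_f) (auto simp: bij_betw_def quot_def)
  have \<pi>I: "\<pi> v = x" if "\<phi> x = v +o E" for v x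
    using that \<pi>[of v] inj[of "\<pi> v" x] by simp
  have \<pi>_add: "\<pi> (u + v) = \<pi> u + \<pi> v" for u v
    by (rule \<pi>I) (simp add: add \<pi> quot_add_cosets[OF sE])
  have \<pi>_scale: "\<pi> (c *s v) = \<iota> c *s \<pi> v" for c v
    by (rule \<pi>I) (simp add: scale \<pi> quot_scale_coset[OF sE])
  have \<pi>_0: "\<pi> 0 = 0" using \<pi>_add[of 0 0] by simp
  have ker: "\<pi> v = 0 \<longleftrightarrow> v \<in> E" for v
  proof -
    have "\<pi> v = 0 \<longleftrightarrow> v +o E = 0 +o E" using \<pi>[of v] \<pi>[of 0] \<pi>_0 inj by metis
    also have "\<dots> \<longleftrightarrow> v \<in> E"
    proof
      assume "v +o E = 0 +o E"
      moreover have "0 +o E \<in> quot E E" unfolding quot_def using vec.subspace_0[OF sE] by (rule imageI)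
      ultimately have "v +o E \<in> quot E E" by simp
      then show "v \<in> E" using mem_quot[OF sE sE subset_refl] by blast
    next
      assume v: "v \<in> E"
      show "v +o E = 0 +o E"
      proof
        show "v +o E \<subseteq> 0 +o E" using v sE by (auto simp: elt_set_plus_def vec.subspace_add)
        show "0 +o E \<subseteq> v +o E"
        proof
          fix x assume "x \<in> 0 +o E"
          then have "x - v \<in> E" using v sE by (auto simp: elt_set_plus_def vec.subspace_diff)
          then show "x \<in> v +o E" unfolding elt_set_plus_def by (auto intro!: bexI[of _ "x - v"])
        qed
      qed
    qed
    finally show ?thesis .
  qed
  have "\<exists>m. m \<noteq> 0 \<and> \<pi> ` F = range (\<lambda>c. c *s m)" if F: "F \<in> \<O>" "F \<noteq> E" for F
  proof -
    have "quot (vec.span (E \<union> F)) E \<in> induced_spread n \<O> E"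
      using induced_partial_spread_subset[OF E] F unfolding induced_partial_spread_def by auto
    then obtain P where P: "is_space 1 P" "quot (vec.span (E \<union> F)) E = \<phi> ` P"
      unfolding spread field_reduction_def by blast
    have "\<pi> ` F = P"
    proof
      show "\<pi> ` F \<subseteq> P"
      proof
        fix x assume "x \<in> \<pi> ` F"
        then obtain f where f: "f \<in> F" "x = \<pi> f" by blast
        then have "f +o E \<in> \<phi> ` P" unfolding P(2)[symmetric] quot_def by (auto simp: vec.span_base)
        then show "x \<in> P" using f \<pi>[of f] inj by auto
      qed
      show "P \<subseteq> \<pi> ` F"
      proof
        fix x assume "x \<in> P"
        then have "\<phi> x \<in> quot (vec.span (E \<union> F)) E" using P(2) by simp
        then obtain v where v: "v \<in> vec.span (E \<union> F)" "\<phi> x = v +o E" by (auto simp: quot_def)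
        obtain e f where ef: "e \<in> E" "f \<in> F" "v = e + f" using joinE[OF v(1) E F(1)] by blast
        then have "\<pi> e = 0" using ker by blast
        then have "x = \<pi> f" using \<pi>I[OF v(2)] \<pi>_add[of e f] ef by simp
        then show "x \<in> \<pi> ` F" using ef by blast
      qed
    qed
    then show ?thesis using P(1) is_space_1_iff by auto
  qed
  then show ?thesis using that[OF \<pi>_add \<pi>_scale ker] by blast
qed

text \<open>Coordinates of the quotient by \<open>E\<close> with \<open>Y\<close> on p = 0,
  \<open>X\<close> on r = 0 and \<open>G\<close> on p = r. The coefficient \<open>a\<close> is the
  slope of \<open>F\<close>; \<open>Y\<close> is excluded because its slope is infinite.\<close>

definition frame_functionals ::
    "('a ^ 'd) set \<Rightarrow> ('a ^ 'd) set \<Rightarrow> ('a ^ 'd) set \<Rightarrow> ('a ^ 'd) set \<Rightarrow>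
      ('a ^ 'd \<Rightarrow> 'k) \<Rightarrow> ('a ^ 'd \<Rightarrow> 'k) \<Rightarrow> bool" where
  "frame_functionals E X Y G p r \<longleftrightarrow> ext_functional \<iota> p \<and> ext_functional \<iota> r \<and>
     (\<forall>v. p v = 0 \<longleftrightarrow> v \<in> vec.span (E \<union> Y)) \<and> (\<forall>v. r v = 0 \<longleftrightarrow> v \<in> vec.span (E \<union> X)) \<and>
     (\<forall>v\<in>G. p v = r v) \<and> (\<forall>F\<in>\<O> - {E, Y}. \<exists>a. \<forall>v\<in>F. r v = a * p v)"

text \<open>Let u, w, g span the points of \<open>X\<close>, \<open>Y\<close>, \<open>G\<close> in
  K^2. The determinants against w and u vanish on the joins with \<open>Y\<close> and
  \<open>X\<close>; division by their values at g normalises them on \<open>G\<close>.\<close>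

lemma frame_functionals_exist:
  assumes O: "E \<in> \<O>" "X \<in> \<O>" "Y \<in> \<O>" "G \<in> \<O>" and dist: "distinct [E, X, Y, G]"
  obtains p r where "frame_functionals E X Y G p r"
proof (rule projection[OF O(1)])
  fix \<pi> :: "'a ^ 'd \<Rightarrow> 'k ^ 2"
  assume add: "\<And>u v. \<pi> (u + v) = \<pi> u + \<pi> v"
    and scale: "\<And>c v. \<pi> (c *s v) = \<iota> c *s \<pi> v" and ker: "\<And>v. \<pi> v = 0 \<longleftrightarrow> v \<in> E"
    and image: "\<And>F. F \<in> \<O> \<Longrightarrow> F \<noteq> E \<Longrightarrow> \<exists>m. m \<noteq> 0 \<and> \<pi> ` F = range (\<lambda>c. c *s m)"
  obtain u where u: "u \<noteq> 0" "\<pi> ` X = range (\<lambda>c. c *s u)" using image[of X] O dist by auto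
  obtain w where w: "w \<noteq> 0" "\<pi> ` Y = range (\<lambda>c. c *s w)" using image[of Y] O dist by auto
  obtain g where g: "g \<noteq> 0" "\<pi> ` G = range (\<lambda>c. c *s g)" using image[of G] O dist by auto
  have join_iff: "v \<in> vec.span (E \<union> F) \<longleftrightarrow> area (\<pi> v) m = 0"
    if F: "F \<in> \<O>" "m \<noteq> 0" "\<pi> ` F = range (\<lambda>c. c *s m)" for F m v
  proof
    assume "v \<in> vec.span (E \<union> F)"
    then obtain e f where ef: "e \<in> E" "f \<in> F" "v = e + f" using joinE[OF _ O(1) F(1)] by blast
    then have "\<pi> v = \<pi> f" using add[of e f] ker[of e] by simp
    then have "\<pi> v \<in> \<pi> ` F" using ef by blast
    then show "area (\<pi> v) m = 0" unfolding F(3) area_eq_0_iff[OF F(2)] by blast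
  next
    assume "area (\<pi> v) m = 0"
    then have "\<pi> v \<in> \<pi> ` F" unfolding F(3) area_eq_0_iff[OF F(2)] by blast
    then obtain f where f: "f \<in> F" "\<pi> v = \<pi> f" by auto
    then have "v - f \<in> E" using additive_diff(1)[of \<pi> v f, OF add] ker[of "v - f"] by simp
    then have "(v - f) + f \<in> vec.span (E \<union> F)" using f joinI by blast
    then show "v \<in> vec.span (E \<union> F)" by simp
  qed
  \<comment> \<open>Different elements give different points, since a representative of
    \<open>m\<close> in \<open>F\<close> would otherwise lie in the join of \<open>E\<close> and
    \<open>F'\<close>.\<close>
  have nz: "area m m' \<noteq> 0"
    if F: "F \<in> \<O>" "F \<noteq> E" "m \<noteq> 0" "\<pi> ` F = range (\<lambda>c. c *s m)"
      and F': "F' \<in> \<O>" "F' \<noteq> E" "m' \<noteq> 0" "\<pi> ` F' = range (\<lambda>c. c *s m')" and "F \<noteq> F'" for F F' m m'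
  proof
    assume *: "area m m' = 0"
    have "1 *s m \<in> \<pi> ` F" unfolding F(4) by blast
    then obtain f where f: "f \<in> F" "\<pi> f = m" by auto
    then have "f \<in> vec.span (E \<union> F')" using join_iff[OF F'(1,3,4)] * by simp
    then have "f = 0" using join_disjoint[of E F' F f] O F F' \<open>F \<noteq> F'\<close> f by auto
    then show False using f F ker[of 0] vec.subspace_0[OF subspace[OF O(1)]] by auto
  qed
  have gw: "area g w \<noteq> 0" using nz[of G g Y w] O dist g w by auto
  have gu: "area g u \<noteq> 0" using nz[of G g X u] O dist g u by auto
  define p where "p v = area (\<pi> v) w / area g w" for v
  define r where "r v = area (\<pi> v) u / area g u" for v
  have "ext_functional \<iota> p" "ext_functional \<iota> r"
    unfolding ext_functional_def p_def r_def
    by (simp_all add: add scale area_add area_scale add_divide_distrib)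
  moreover have "p v = 0 \<longleftrightarrow> v \<in> vec.span (E \<union> Y)" "r v = 0 \<longleftrightarrow> v \<in> vec.span (E \<union> X)" for v
    unfolding p_def r_def using gw gu join_iff[OF O(3) w] join_iff[OF O(2) u] by simp_all
  moreover have "p v = r v" if "v \<in> G" for v
  proof -
    have "\<pi> v \<in> \<pi> ` G" using that by blast
    then obtain c where "\<pi> v = c *s g" using g by auto
    then show ?thesis unfolding p_def r_def using gw gu by (simp add: area_scale)
  qed
  moreover have "\<exists>a. \<forall>v\<in>F. r v = a * p v" if F: "F \<in> \<O>" "F \<noteq> E" "F \<noteq> Y" for F
  proof -
    obtain m where m: "m \<noteq> 0" "\<pi> ` F = range (\<lambda>c. c *s m)" using image[OF F(1,2)] by blast
    have mw: "area m w \<noteq> 0" using nz[OF F(1,2) m O(3) _ w F(3)] dist by auto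
    have "r v = ((area m u / area g u) / (area m w / area g w)) * p v" if "v \<in> F" for v
    proof -
      have "\<pi> v \<in> \<pi> ` F" using that by blast
      then obtain c where "\<pi> v = c *s m" using m by auto
      then show ?thesis unfolding p_def r_def using gw gu mw by (simp add: area_scale)
    qed
    then show ?thesis by blast
  qed
  ultimately have "frame_functionals E X Y G p r"
    unfolding frame_functionals_def by simp
  then show ?thesis by (rule that)
qed

text \<open>\<open>F\<close> meets the kernel only in 0 and has q^n elements, as many as
  \<open>'k\<close>.\<close>

lemma functional_bij:
  assumes p: "ext_functional \<iota> p" and ker: "\<And>v. p v = 0 \<longleftrightarrow> v \<in> vec.span (E \<union> Y)"
    and O: "E \<in> \<O>" "Y \<in> \<O>" "F \<in> \<O>" and dist: "distinct [E, Y, F]"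
  shows "bij_betw p F (UNIV :: 'k set)"
proof -
  have inj: "inj_on p F"
  proof (rule inj_onI)
    fix u v assume uv: "u \<in> F" "v \<in> F" "p u = p v"
    then have "u - v \<in> vec.span (E \<union> Y)" using ker ext_functional_diff[OF p] by (metis eq_iff_diff_eq_0)
    moreover have "u - v \<in> F" using uv O subspace vec.subspace_diff by blast
    ultimately have "u - v = 0" using join_disjoint[of E Y F "u - v"] O dist by auto
    then show "u = v" by simp
  qed
  then have "card (p ` F) = CARD('k)" using O by (simp add: card_image card_elem card_ext)
  then have "p ` F = UNIV" by (intro card_subset_eq) auto
  then show ?thesis using inj by (simp add: bij_betw_def)
qed

end

section \<open>Frames of a pseudo-oval\<close>

context desarguesian_oval
begin

lemma functional_surj:
  assumes "ext_functional \<iota> p" "\<And>v. p v = 0 \<longleftrightarrow> v \<in> vec.span (E \<union> Y)" "E \<in> \<O>" "Y \<in> \<O>" "E \<noteq> Y"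
  shows "surj (p :: 'a ^ 'd \<Rightarrow> 'k)"
proof -
  have "card {E, Y} \<le> 3" by (simp add: card_insert_if)
  then obtain F where F: "F \<in> \<O>" "F \<notin> {E, Y}" using avoid by blast
  have "bij_betw p F UNIV"
    using F assms by (intro functional_bij[of p E Y]) auto
  then show ?thesis by (auto simp: bij_betw_def)
qed

context
  fixes E X Y G p r
  assumes fr: "frame_functionals E X Y G p r"
    and O: "E \<in> \<O>" "X \<in> \<O>" "Y \<in> \<O>" "G \<in> \<O>" and dist: "distinct [E, X, Y, G]"
begin

lemma frame_p: "ext_functional \<iota> p" and frame_r: "ext_functional \<iota> r"
  and frame_p_ker: "p v = 0 \<longleftrightarrow> v \<in> vec.span (E \<union> Y)"
  and frame_r_ker: "r v = 0 \<longleftrightarrow> v \<in> vec.span (E \<union> X)"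
  and frame_unit: "v \<in> G \<Longrightarrow> p v = r v"
  and frame_coeff: "F \<in> \<O> \<Longrightarrow> F \<noteq> E \<Longrightarrow> F \<noteq> Y \<Longrightarrow> \<exists>a. \<forall>v\<in>F. r v = a * p v"
  using fr unfolding frame_functionals_def by auto

lemma frame_p_bij: "F \<in> \<O> \<Longrightarrow> F \<noteq> E \<Longrightarrow> F \<noteq> Y \<Longrightarrow> bij_betw p F UNIV"
  using O dist by (intro functional_bij[OF frame_p frame_p_ker]) auto

lemma frame_p_pick:
  assumes "F \<in> \<O>" "F \<noteq> E" "F \<noteq> Y"
  obtains v where "v \<in> F" "p v = x"
  using frame_p_bij[OF assms] unfolding bij_betw_def by (metis UNIV_I imageE)

text \<open>After subtraction of the vector of \<open>F\<close> with the same \<open>p\<close>-value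
  both coordinates vanish, so the rest lies in two joins with \<open>E\<close>, hence in
  \<open>E\<close>.\<close>

lemma coeff_kernel:
  assumes F: "F \<in> \<O>" "F \<noteq> E" "F \<noteq> Y" and a: "\<And>v. v \<in> F \<Longrightarrow> r v = a * p v"
  shows "r v = a * p v \<longleftrightarrow> v \<in> vec.span (E \<union> F)"
proof
  assume v: "r v = a * p v"
  obtain u where u: "u \<in> F" "p u = p v" using frame_p_pick[OF F] by blast
  then have "p (v - u) = 0" "r (v - u) = 0"
    using a v by (simp_all add: ext_functional_diff[OF frame_p] ext_functional_diff[OF frame_r])
  then have "v - u \<in> E" using frame_p_ker frame_r_ker joins_meet[of E Y X "v - u"] O dist by auto
  then have "(v - u) + u \<in> vec.span (E \<union> F)" using u joinI by blast
  then show "v \<in> vec.span (E \<union> F)" by simp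
next
  assume "v \<in> vec.span (E \<union> F)"
  then obtain e f where ef: "e \<in> E" "f \<in> F" "v = e + f" using joinE[OF _ O(1) F(1)] by blast
  then have "p e = 0" "r e = 0" using frame_p_ker frame_r_ker by (auto simp: vec.span_base)
  then show "r v = a * p v"
    using a ef by (simp add: ext_functional_add[OF frame_p] ext_functional_add[OF frame_r])
qed

lemma coeff_inj:
  assumes F: "F \<in> \<O>" "F \<noteq> E" "F \<noteq> Y" "\<And>v. v \<in> F \<Longrightarrow> r v = a * p v"
    and F': "F' \<in> \<O>" "F' \<noteq> E" "F' \<noteq> Y" "\<And>v. v \<in> F' \<Longrightarrow> r v = a * p v"
  shows "F = F'"
proof (rule ccontr)
  assume "F \<noteq> F'"
  obtain v where v: "v \<in> F'" "p v = 1" using frame_p_pick[OF F'(1-3)] by blast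
  then have "v \<in> vec.span (E \<union> F)" using coeff_kernel[OF F] F'(4) by blast
  then have "v = 0" using join_disjoint[of E F F' v] v F(1,2) F'(1,2) O \<open>F \<noteq> F'\<close> by auto
  then show False using v ext_functional_0[OF frame_p] by simp
qed

text \<open>\<open>X\<close> is replaced by \<open>G\<close>, and \<open>G\<close> by
  \<open>H\<close>. A slope d becomes (d - 1) / (a - 1), while \<open>p\<close> stays; hence the map
  comparing the quotients by two elements, and with it both field structures, can be kept.\<close>

lemma frame_change:
  assumes H: "H \<in> \<O>" "H \<noteq> E" "H \<noteq> Y" "H \<noteq> G" and a: "\<And>v. v \<in> H \<Longrightarrow> r v = a * p v"
  shows "a \<noteq> 1" and "frame_functionals E G Y H p (\<lambda>v. (r v - p v) / (a - 1))"
proof -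
  have G: "G \<noteq> E" "G \<noteq> Y" "\<And>v. v \<in> G \<Longrightarrow> r v = 1 * p v" using dist frame_unit by auto
  show a1: "a \<noteq> 1"
  proof
    assume "a = 1"
    then have "H = G" using coeff_inj[OF H(1-3) a O(4) G(1,2)] G(3) by simp
    then show False using H by simp
  qed
  have "ext_functional \<iota> (\<lambda>v. (r v - p v) / (a - 1))"
    using frame_p frame_r unfolding ext_functional_def by (simp add: add_divide_distrib diff_divide_distrib right_diff_distrib)
  moreover have "(r v - p v) / (a - 1) = 0 \<longleftrightarrow> v \<in> vec.span (E \<union> G)" for v
    using coeff_kernel[OF O(4) G] a1 by simp
  moreover have "p v = (r v - p v) / (a - 1)" if "v \<in> H" for v
    using a[OF that] a1 by (simp add: field_simps)
  moreover have "\<exists>c. \<forall>v\<in>F. (r v - p v) / (a - 1) = c * p v" if F: "F \<in> \<O>" "F \<noteq> E" "F \<noteq> Y" for F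
  proof -
    obtain d where "\<forall>v\<in>F. r v = d * p v" using frame_coeff[OF F] by blast
    then have "\<forall>v\<in>F. (r v - p v) / (a - 1) = ((d - 1) / (a - 1)) * p v" by (simp add: left_diff_distrib)
    then show ?thesis by blast
  qed
  ultimately show "frame_functionals E G Y H p (\<lambda>v. (r v - p v) / (a - 1))"
    unfolding frame_functionals_def using frame_p frame_p_ker by simp
qed

end

text \<open>The functionals at \<open>Z\<close> and \<open>Y\<close> coordinatise the quotients by \<open>Z\<close> and \<open>Y\<close>; the quotient by
  \<open>X\<close> relates the two coefficients of every element through a third field structure \<open>\<eta>\<close>.\<close>

lemma third_quotient:
  assumes O: "X \<in> \<O>" "Y \<in> \<O>" "Z \<in> \<O>" "G \<in> \<O>" and dist: "distinct [X, Y, Z, G]"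
    and frZ: "frame_functionals Z X Y G p r" and frY: "frame_functionals Y X Z G p' r'"
    and \<theta>: "ext_linear_bij \<iota> \<theta>" "\<And>v. p' v = \<theta> (p v)"
  obtains \<eta> where "ext_linear_bij \<iota> \<eta>"
    "\<And>F a b. F \<in> \<O> - {X, Y, Z} \<Longrightarrow> \<forall>v\<in>F. r v = a * p v \<Longrightarrow> \<forall>v\<in>F. r' v = b * p' v \<Longrightarrow>
      \<exists>c. \<forall>x. c * \<eta> (a * x) = \<eta> (conj_mult \<theta> b x)"
proof -
  have dZ: "distinct [Z, X, Y, G]" and dY: "distinct [Y, X, Z, G]" and dX: "distinct [X, Y, Z, G]"
    using dist by auto
  note fZ = frZ O(3) O(1) O(2) O(4) dZ
  note fY = frY O(2) O(1) O(3) O(4) dY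
  obtain p'' r'' where frX: "frame_functionals X Y Z G p'' r''"
    using frame_functionals_exist[OF O dX] by blast
  note fX = frX O dX
  have r: "surj r"
    using functional_surj[OF frame_r[OF fZ] frame_r_ker[OF fZ]] O dist by auto
  have r': "surj r'"
    using functional_surj[OF frame_r[OF fY] frame_r_ker[OF fY]] O dist by auto
  \<comment> \<open>Both \<open>r\<close> and \<open>p''\<close> vanish exactly on the join of
    \<open>X\<close> and \<open>Z\<close>; further below, \<open>r'\<close> and \<open>r''\<close>
    do so on the join of \<open>X\<close> and \<open>Y\<close>.\<close>
  have "r v = 0 \<longleftrightarrow> p'' v = 0" for v
    using frame_r_ker[OF fZ, of v] frame_p_ker[OF fX, of v] by (simp add: Un_commute)
  then obtain \<eta> where \<eta>: "ext_linear_bij \<iota> \<eta>" "\<And>v. p'' v = \<eta> (r v)"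
    using ext_functional_comparison[OF frame_r[OF fZ] r frame_p[OF fX]] by blast
  have "r' v = 0 \<longleftrightarrow> r'' v = 0" for v
    using frame_r_ker[OF fY, of v] frame_r_ker[OF fX, of v] by (simp add: Un_commute)
  then obtain \<zeta> where \<zeta>: "ext_linear_bij \<iota> \<zeta>" "\<And>v. r'' v = \<zeta> (r' v)"
    using ext_functional_comparison[OF frame_r[OF fY] r' frame_r[OF fX]] by blast
  \<comment> \<open>All three pairs of functionals are normalised on the same \<open>G\<close>,
    which links the three comparison maps.\<close>
  have \<eta>\<zeta>: "\<eta> x = \<zeta> (\<theta> x)" for x
  proof -
    obtain v where v: "v \<in> G" "p v = x" using frame_p_pick[OF fZ O(4)] dist by auto
    have "\<eta> x = p'' v" using \<eta>(2) frame_unit[OF fZ v(1)] v(2) by simp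
    also have "\<dots> = \<zeta> (\<theta> x)" using frame_unit[OF fX v(1)] frame_unit[OF fY v(1)] \<zeta>(2) \<theta>(2) v(2) by simp
    finally show ?thesis .
  qed
  have "\<exists>c. \<forall>x. c * \<eta> (a * x) = \<eta> (conj_mult \<theta> b x)"
    if F: "F \<in> \<O> - {X, Y, Z}" and a: "\<forall>v\<in>F. r v = a * p v" and b: "\<forall>v\<in>F. r' v = b * p' v" for F a b
  proof -
    obtain c where c: "\<forall>v\<in>F. r'' v = c * p'' v" using frame_coeff[OF fX, of F] F by auto
    \<comment> \<open>Evaluate \<open>r''\<close> in two ways at the vector of \<open>F\<close> with
      \<open>p v = x\<close>.\<close>
    have "c * \<eta> (a * x) = \<eta> (conj_mult \<theta> b x)" for x
    proof -
      obtain v where v: "v \<in> F" "p v = x" using frame_p_pick[OF fZ, of F] F by auto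
      have "c * \<eta> (a * x) = r'' v" using a c v \<eta>(2) by simp
      also have "\<dots> = \<zeta> (b * \<theta> x)" using b v \<zeta>(2) \<theta>(2) by simp
      also have "\<dots> = \<eta> (conj_mult \<theta> b x)" by (simp add: \<eta>\<zeta> conj_mult_def ext_linear_bij_inv[OF \<theta>(1)])
      finally show ?thesis .
    qed
    then show ?thesis by blast
  qed
  then show ?thesis using that \<eta>(1) by blast
qed

end

section \<open>The field structures at two elements coincide\<close>

context desarguesian_oval
begin

lemma card_preimage_le:
  assumes "inj_on A C" "finite S"
  shows "card {F\<in>C. A F \<in> S} \<le> card S"
proof (rule card_inj_on_le[of A])
  show "inj_on A {F\<in>C. A F \<in> S}" using assms(1) by (rule inj_on_subset) auto
qed (use assms in auto)

text \<open>\<open>multipliers \<theta>\<close> is the intersection of the field structures at \<open>Z\<close> and \<open>Y\<close>. When it is only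
  \<open>GF(q)\<close>, compare the frames \<open>X, Y, Z, G\<close> and \<open>G, Y, Z, H\<close>, with both coefficients of \<open>H\<close>
  outside \<open>GF(q)\<close>, on an element \<open>F\<close> of the subline determined by \<open>G\<close> and \<open>H\<close>. That \<open>F\<close> is not
  the nucleus, which is not an element, is where \<open>q - 2 > 1\<close> is used.\<close>

lemma multipliers_eq_UNIV:
  assumes O: "X \<in> \<O>" "Y \<in> \<O>" "Z \<in> \<O>" "G \<in> \<O>" and dist: "distinct [X, Y, Z, G]"
    and frZ: "frame_functionals Z X Y G p r" and frY: "frame_functionals Y X Z G p' r'"
    and \<theta>: "ext_linear_bij \<iota> \<theta>" "\<And>v. p' v = \<theta> (p v)"
  shows "multipliers \<theta> = UNIV"
proof (rule ccontr)
  assume "multipliers \<theta> \<noteq> UNIV"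
  then have m\<theta>: "multipliers \<theta> = range \<iota>" using multipliers_cases[OF \<theta>(1)] by blast
  have dZ: "distinct [Z, X, Y, G]" and dY: "distinct [Y, X, Z, G]" using dist by auto
  note fZ = frZ O(3) O(1) O(2) O(4) dZ
  note fY = frY O(2) O(1) O(3) O(4) dY
  define C where "C = \<O> - {X, Y, Z}"
  have C: "F \<in> \<O>" "F \<noteq> X" "F \<noteq> Y" "F \<noteq> Z" if "F \<in> C" for F using that C_def by auto
  have GC: "G \<in> C" using C_def O dist by auto
  have finC: "finite C" using C_def finite_oval by simp
  define q where "q = CARD('a)"
  define Q where "Q = CARD('k)"
  have q4: "q \<ge> 4" using card_scalars q_def by simp
  have Q: "Q \<ge> q * q"
  proof -
    have "q ^ 2 \<le> q ^ n" using q4 n_gt_1 by (intro power_increasing) auto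
    then show ?thesis using card_ext by (simp add: q_def Q_def power2_eq_square)
  qed
  then have Qq: "Q \<ge> 4 * q" using q4 by (meson le_trans mult_le_mono1)
  have cardC: "card C = Q - 2"
    unfolding C_def using O dist finite_oval card_oval card_ext
    by (simp add: card_Diff_insert Q_def)
  have "\<forall>F\<in>C. \<exists>a. \<forall>v\<in>F. r v = a * p v" using frame_coeff[OF fZ] C by blast
  then obtain A where A: "\<And>F v. F \<in> C \<Longrightarrow> v \<in> F \<Longrightarrow> r v = A F * p v" by metis
  have "\<forall>F\<in>C. \<exists>b. \<forall>v\<in>F. r' v = b * p' v" using frame_coeff[OF fY] C by blast
  then obtain B where B: "\<And>F v. F \<in> C \<Longrightarrow> v \<in> F \<Longrightarrow> r' v = B F * p' v" by metis
  have injA: "inj_on A C"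
  proof (rule inj_onI)
    fix F F' assume F: "F \<in> C" "F' \<in> C" "A F = A F'"
    then show "F = F'"
      using coeff_inj[OF fZ C(1,4,3)[OF F(1)] A[OF F(1)] C(1,4,3)[OF F(2)]] A[OF F(2)] by simp
  qed
  have injB: "inj_on B C"
  proof (rule inj_onI)
    fix F F' assume F: "F \<in> C" "F' \<in> C" "B F = B F'"
    then show "F = F'"
      using coeff_inj[OF fY C(1,3,4)[OF F(1)] B[OF F(1)] C(1,3,4)[OF F(2)]] B[OF F(2)] by simp
  qed
  have A0: "A F \<noteq> 0" if F: "F \<in> C" for F
  proof
    assume "A F = 0"
    moreover have "r v = 0 * p v" if "v \<in> X" for v
      using frame_r_ker[OF fZ] that by (simp add: vec.span_base)
    ultimately have "X = F"
      using coeff_inj[OF fZ O(1) _ _ _ C(1,4,3)[OF F], of 0] A[OF F] dist by simp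
    then show False using C[OF F] by simp
  qed
  have "A G = 1"
  proof -
    obtain v where v: "v \<in> G" "p v = 1" using frame_p_pick[OF fZ O(4)] dist by auto
    have "r v = A G" using A[OF GC v(1)] v(2) by simp
    then show ?thesis using frame_unit[OF fZ v(1)] v(2) by simp
  qed
  have "B G = 1"
  proof -
    obtain v where v: "v \<in> G" "p' v = 1" using frame_p_pick[OF fY O(4)] dist by auto
    have "r' v = B G" using B[OF GC v(1)] v(2) by simp
    then show ?thesis using frame_unit[OF fY v(1)] v(2) by simp
  qed
  have cardR: "card (range \<iota>) = q" using card_range q_def by simp

  \<comment> \<open>Each coefficient lies in GF(q) for at most q elements, while \<open>C\<close>
    has Q - 2 > 2 q of them.\<close>
  have "\<exists>H\<in>C. A H \<notin> range \<iota> \<and> B H \<notin> range \<iota>"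
  proof (rule ccontr)
    assume "\<not> ?thesis"
    then have "C \<subseteq> {F\<in>C. A F \<in> range \<iota>} \<union> {F\<in>C. B F \<in> range \<iota>}" by blast
    then have "card C \<le> card ({F\<in>C. A F \<in> range \<iota>} \<union> {F\<in>C. B F \<in> range \<iota>})"
      using finC by (intro card_mono) auto
    also have "\<dots> \<le> card {F\<in>C. A F \<in> range \<iota>} + card {F\<in>C. B F \<in> range \<iota>}" by (rule card_Un_le)
    also have "\<dots> \<le> q + q"
      using card_preimage_le[OF injA, of "range \<iota>"] card_preimage_le[OF injB, of "range \<iota>"] cardR
      by simp
    finally show False using cardC Qq q4 by simp
  qed
  then obtain H where H: "H \<in> C" "A H \<notin> range \<iota>" "B H \<notin> range \<iota>" by blast
  define a where "a = A H"
  define b where "b = B H"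
  have HG: "H \<noteq> G" using H \<open>A G = 1\<close> \<iota>_1 by (metis rangeI)
  have a1: "a \<noteq> 1" and b1: "b \<noteq> 1"
    using H(2,3) \<iota>_1 unfolding a_def b_def by (metis rangeI)+
  let ?rZ = "\<lambda>v. (r v - p v) / (a - 1)" and ?rY = "\<lambda>v. (r' v - p' v) / (b - 1)"
  have frZ2: "frame_functionals Z G Y H p ?rZ"
    using frame_change(2)[OF fZ C(1,4,3)[OF H(1)] HG A[OF H(1)]] a_def by simp
  have frY2: "frame_functionals Y G Z H p' ?rY"
    using frame_change(2)[OF fY C(1,3,4)[OF H(1)] HG B[OF H(1)]] b_def by simp

  \<comment> \<open>At most q slopes lie on the subline of \<open>G\<close> and \<open>H\<close>. An
    element off it serves as the other element in \<open>scalar_to_scalar\<close>.\<close>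
  have "\<exists>H1\<in>C. (A H1 - 1) / (a - 1) \<notin> range \<iota>"
  proof (rule ccontr)
    let ?S = "(\<lambda>x. 1 + x * (a - 1)) ` range \<iota>"
    assume "\<not> ?thesis"
    then have *: "(A F - 1) / (a - 1) \<in> range \<iota>" if "F \<in> C" for F using that by blast
    have "A F \<in> ?S" if "F \<in> C" for F
      using *[OF that] by (rule rev_image_eqI) (use a1 in simp)
    then have "C = {F\<in>C. A F \<in> ?S}" by blast
    then have "card C \<le> card ?S" using card_preimage_le[OF injA, of ?S] by simp
    also have "\<dots> \<le> q" using card_image_le[of "range \<iota>"] cardR by simp
    finally show False using cardC Qq q4 by simp
  qed
  then obtain H1 where H1: "H1 \<in> C" "(A H1 - 1) / (a - 1) \<notin> range \<iota>" by blast
  \<comment> \<open>The elements of \<open>C\<close> have Q - 2 distinct slopes among the Q - 1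
    nonzero values, so only one is missed, whereas q - 2 \<ge> 2 values of \<open>t\<close> are
    available.\<close>
  have "\<exists>F t. F \<in> C \<and> A F = 1 + \<iota> t * (a - 1) \<and> t \<noteq> 0 \<and> t \<noteq> 1"
  proof (rule ccontr)
    let ?T = "(\<lambda>t. 1 + \<iota> t * (a - 1)) ` (UNIV - {0, 1})"
    assume none: "\<not> ?thesis"
    have disj: "?T \<inter> A ` C = {}"
    proof (rule equals0I)
      fix x assume "x \<in> ?T \<inter> A ` C"
      then obtain F t where "F \<in> C" "x = A F" "x = 1 + \<iota> t * (a - 1)" "t \<noteq> 0" "t \<noteq> 1" by auto
      then show False using none by metis
    qed
    have "inj_on (\<lambda>t. 1 + \<iota> t * (a - 1)) (UNIV - {0, 1})"
      using a1 inj_\<iota> by (auto simp: inj_on_def)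
    then have cT: "card ?T = q - 2" by (simp add: card_image card_Diff_subset q_def)
    \<comment> \<open>The slope 0, which belongs to \<open>X\<close>, is not on this part of the
      subline: it would make \<open>a\<close> a scalar.\<close>
    have T0: "0 \<notin> ?T"
    proof
      assume "0 \<in> ?T"
      then obtain t where "t \<in> UNIV - {0, 1}" "0 = 1 + \<iota> t * (a - 1)" by blast
      then have t: "t \<noteq> 0" "1 + \<iota> t * (a - 1) = 0" by auto
      then have "\<iota> t * a = \<iota> t - 1" by (simp add: algebra_simps eq_neg_iff_add_eq_0)
      then have "a = (\<iota> t - 1) / \<iota> t" using t(1) by (simp add: \<iota>_eq_0_iff field_simps)
      then have "a = \<iota> ((t - 1) / t)" by (simp add: \<iota>_divide \<iota>_diff \<iota>_1)
      then show False using H(2) a_def by (metis rangeI)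
    qed
    have "card (insert 0 ?T \<union> A ` C) = card (insert 0 ?T) + card (A ` C)"
      using disj A0 finC by (intro card_Un_disjoint) auto
    also have "\<dots> = (q - 1) + (Q - 2)"
      using T0 cT cardC injA q4 by (simp add: card_image)
    finally have "(q - 1) + (Q - 2) \<le> Q"
      unfolding Q_def using card_mono[of "UNIV :: 'k set" "insert 0 ?T \<union> A ` C"] by simp
    then show False using q4 Qq by simp
  qed
  then obtain F t where F: "F \<in> C" "A F = 1 + \<iota> t * (a - 1)" and t: "t \<noteq> 0" "t \<noteq> 1" by blast
  have AG: "A F' \<noteq> 1 \<and> B F' \<noteq> 1 \<and> F' \<in> \<O> - {G, Y, Z}" if "F' \<in> C" "F' \<noteq> G" for F'
    using inj_on_eq_iff[OF injA that(1) GC] inj_on_eq_iff[OF injB that(1) GC] that(2)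
      \<open>A G = 1\<close> \<open>B G = 1\<close> C[OF that(1)] by simp
  have FG: "F \<noteq> G"
  proof
    assume "F = G"
    then have "\<iota> t * (a - 1) = 0" using F \<open>A G = 1\<close> by simp
    then show False using t a1 by (simp add: \<iota>_eq_0_iff)
  qed
  have H1G: "H1 \<noteq> G" using H1(2) \<open>A G = 1\<close> \<iota>_0 by (metis diff_self div_0 rangeI)

  have rZ: "\<forall>v\<in>F'. ?rZ v = ((A F' - 1) / (a - 1)) * p v"
    and rY: "\<forall>v\<in>F'. ?rY v = ((B F' - 1) / (b - 1)) * p' v" if "F' \<in> C" for F'
    using A[OF that] B[OF that] by (simp_all add: left_diff_distrib)
  have d2: "distinct [G, Y, Z, H]" using dist HG C[OF H(1)] by auto
  \<comment> \<open>The functionals \<open>p\<close> and \<open>p'\<close> are kept in the frame G,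
    Y, Z, H, so the same \<theta> applies.\<close>
  obtain \<eta>' where \<eta>': "ext_linear_bij \<iota> \<eta>'"
    "\<And>F a b. F \<in> \<O> - {G, Y, Z} \<Longrightarrow> \<forall>v\<in>F. ?rZ v = a * p v \<Longrightarrow> \<forall>v\<in>F. ?rY v = b * p' v \<Longrightarrow>
      \<exists>c. \<forall>x. c * \<eta>' (a * x) = \<eta>' (conj_mult \<theta> b x)"
    using third_quotient[OF O(4,2,3) C(1)[OF H(1)] d2 frZ2 frY2 \<theta>] by blast
  have "(A F - 1) / (a - 1) = \<iota> t" using F(2) a1 by simp
  then obtain c where c: "\<And>x. c * \<eta>' (\<iota> t * x) = \<eta>' (conj_mult \<theta> ((B F - 1) / (b - 1)) x)"
    using \<eta>'(2)[OF _ rZ[OF F(1)] rY[OF F(1)]] AG[OF F(1) FG] by auto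
  obtain c1 where c1:
    "\<And>x. c1 * \<eta>' (((A H1 - 1) / (a - 1)) * x) = \<eta>' (conj_mult \<theta> ((B H1 - 1) / (b - 1)) x)"
    using \<eta>'(2)[OF _ rZ[OF H1(1)] rY[OF H1(1)]] AG[OF H1(1) H1G] by auto
  have "(B H1 - 1) / (b - 1) \<noteq> 0" using AG[OF H1(1) H1G] b1 by simp
  \<comment> \<open>In the new frame the first coefficient of \<open>F\<close> is the scalar
    \<open>t\<close>, so the second is a scalar too.\<close>
  then have "(B F - 1) / (b - 1) \<in> range \<iota>"
    by (rule scalar_to_scalar[OF \<theta>(1) m\<theta> \<eta>'(1) c c1 H1(2)])
  then obtain g where g: "(B F - 1) / (b - 1) = \<iota> g" by blast
  then have BF: "B F = 1 + \<iota> g * (b - 1)" using b1 by (simp add: field_simps)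
  have g0: "g \<noteq> 0" using BF AG[OF F(1) FG] by (auto simp: \<iota>_0)

  \<comment> \<open>Back in the old frame, \<open>H\<close> and \<open>F\<close> supply the two
    relations for \<open>affine_line_contradiction\<close>.\<close>
  obtain \<eta> where \<eta>: "ext_linear_bij \<iota> \<eta>"
    "\<And>F a b. F \<in> \<O> - {X, Y, Z} \<Longrightarrow> \<forall>v\<in>F. r v = a * p v \<Longrightarrow> \<forall>v\<in>F. r' v = b * p' v \<Longrightarrow>
      \<exists>c. \<forall>x. c * \<eta> (a * x) = \<eta> (conj_mult \<theta> b x)"
    using third_quotient[OF O dist frZ frY \<theta>] by blast
  have third: "\<exists>c. \<forall>x. c * \<eta> (A F' * x) = \<eta> (conj_mult \<theta> (B F') x)" if "F' \<in> C" for F'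
    using \<eta>(2)[OF that[unfolded C_def], of "A F'" "B F'"] A[OF that] B[OF that] by simp
  obtain d where d: "\<And>x. d * \<eta> (a * x) = \<eta> (conj_mult \<theta> b x)"
    using third[OF H(1)] unfolding a_def b_def by blast
  obtain d1 where d1: "\<And>x. d1 * \<eta> ((1 + \<iota> t * (a - 1)) * x) = \<eta> (conj_mult \<theta> (1 + \<iota> g * (b - 1)) x)"
    using third[OF F(1)] unfolding F(2) BF by blast
  show False
    by (rule affine_line_contradiction[OF \<theta>(1) m\<theta> \<eta>(1) d _ _ d1 t(2) g0])
      (use H(2,3) a_def b_def in simp_all)
qed

section \<open>Common coordinates over GF(q^n)\<close>

lemma oval_frame:
  obtains X Y Z G where "X \<in> \<O>" "Y \<in> \<O>" "Z \<in> \<O>" "G \<in> \<O>" "distinct [X, Y, Z, G]"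
proof -
  obtain X where X: "X \<in> \<O>" using avoid[of "{}"] by auto
  obtain Y where Y: "Y \<in> \<O>" "Y \<notin> {X}" using avoid[of "{X}"] by auto
  have "card {X, Y} \<le> 3" by (simp add: card_insert_if)
  then obtain Z where Z: "Z \<in> \<O>" "Z \<notin> {X, Y}" using avoid by blast
  have "card {X, Y, Z} \<le> 3" by (simp add: card_insert_if)
  then obtain G where G: "G \<in> \<O>" "G \<notin> {X, Y, Z}" using avoid by blast
  have "distinct [X, Y, Z, G]" using Y Z G by auto
  then show ?thesis using that X Y Z G by blast
qed

text \<open>By counting, \<kappa> is bijective, and its inverse is the field reduction. A line
  through three of the points would be the sum of two of them, so the third element would lie in the
  join of the other two.\<close>

lemma elementary_if_spaces:
  fixes \<kappa> :: "'a ^ 'd \<Rightarrow> 'k ^ 3"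
  assumes add: "\<And>u v. \<kappa> (u + v) = \<kappa> u + \<kappa> v" and scale: "\<And>c v. \<kappa> (c *s v) = \<iota> c *s \<kappa> v"
    and ker: "\<And>v. \<kappa> v = 0 \<Longrightarrow> v = 0" and space: "\<And>F. F \<in> \<O> \<Longrightarrow> is_space 1 (\<kappa> ` F)"
  shows "elementary \<iota> \<O>"
proof -
  have inj: "inj \<kappa>"
  proof (rule injI)
    fix u v assume "\<kappa> u = \<kappa> v"
    then have "\<kappa> (u - v) = 0" using additive_diff(1)[of \<kappa>, OF add] by simp
    then show "u = v" using ker[of "u - v"] by simp
  qed
  have "CARD('a ^ 'd) = CARD('k ^ 3)"
    by (simp add: dim_space card_ext power_mult[symmetric] mult.commute)
  then have "card (range \<kappa>) = CARD('k ^ 3)" using inj by (simp add: card_image)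
  then have "range \<kappa> = UNIV" by (intro card_subset_eq) auto
  then have bij: "bij \<kappa>" using inj by (simp add: bij_def)
  let ?\<phi> = "inv \<kappa>"
  have \<phi>\<kappa>: "?\<phi> (\<kappa> v) = v" for v using inj by simp
  have \<kappa>\<phi>: "\<kappa> (?\<phi> x) = x" for x using bij by (simp add: bij_def surj_f_inv_f)
  have \<kappa>0: "\<kappa> 0 = 0" by (rule additive_diff(2)[of \<kappa>, OF add])
  define \<P> where "\<P> = (\<lambda>F. \<kappa> ` F) ` \<O>"
  have "reduction_iso \<iota> UNIV (+) (*s) ?\<phi>"
    unfolding reduction_iso_def
  proof (intro conjI allI)
    show "bij_betw ?\<phi> UNIV UNIV" using bij by (rule bij_imp_bij_inv)
    show "?\<phi> (x + y) = ?\<phi> x + ?\<phi> y" for x y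
      using \<phi>\<kappa>[of "?\<phi> x + ?\<phi> y"] by (simp add: add \<kappa>\<phi>)
    show "?\<phi> (\<iota> c *s x) = c *s ?\<phi> x" for c x
      using \<phi>\<kappa>[of "c *s ?\<phi> x"] by (simp add: scale \<kappa>\<phi>)
  qed
  moreover have "is_arc \<P>"
    unfolding is_arc_def
  proof (intro conjI ballI impI notI)
    show "is_space 1 P" if "P \<in> \<P>" for P using that space \<P>_def by auto
  next
    fix P Q R assume "P \<in> \<P>" "Q \<in> \<P>" "R \<in> \<P>" and ne: "P \<noteq> Q \<and> P \<noteq> R \<and> Q \<noteq> R"
      and "\<exists>L. is_space 2 L \<and> P \<subseteq> L \<and> Q \<subseteq> L \<and> R \<subseteq> L"
    then obtain E1 E2 E3 L where E: "E1 \<in> \<O>" "E2 \<in> \<O>" "E3 \<in> \<O>" "P = \<kappa> ` E1" "Q = \<kappa> ` E2" "R = \<kappa> ` E3"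
      and L: "vec.subspace L" "vec.dim L = 2" "P \<subseteq> L" "Q \<subseteq> L" "R \<subseteq> L"
      unfolding \<P>_def is_space_def by blast
    have E_ne: "E1 \<noteq> E2" "E1 \<noteq> E3" "E2 \<noteq> E3" using ne E by auto
    have P: "vec.subspace P" "vec.dim P = 1" and Q: "vec.subspace Q" "vec.dim Q = 1"
      using space E(1,2) E(4,5) unfolding is_space_def by auto
    have "P \<inter> Q = {0}"
    proof -
      have "x = 0" if x: "x \<in> P" "x \<in> Q" for x
      proof -
        obtain u where u: "u \<in> E1" "x = \<kappa> u" using x(1) E(4) by blast
        obtain v where v: "v \<in> E2" "x = \<kappa> v" using x(2) E(5) by blast
        have "u = v" using inj u(2) v(2) by (simp add: inj_eq)
        then have "u = 0" using disjoint[OF E(1,2) E_ne(1)] u(1) v(1) by blast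
        then show ?thesis using u(2) \<kappa>0 by simp
      qed
      then show ?thesis using P Q vec.subspace_0 by blast
    qed
    then have "vec.dim {x + y |x y. x \<in> P \<and> y \<in> Q} = 2"
      using vec.dim_sums_Int[OF P(1) Q(1)] P(2) Q(2) by simp
    moreover have "{x + y |x y. x \<in> P \<and> y \<in> Q} \<subseteq> L"
      using L vec.subspace_add by blast
    moreover have "vec.subspace {x + y |x y. x \<in> P \<and> y \<in> Q}"
      by (rule vec.subspace_sums[OF P(1) Q(1)])
    ultimately have L_eq: "{x + y |x y. x \<in> P \<and> y \<in> Q} = L"
      using L by (intro vec.subspace_dim_equal) auto
    have "v = 0" if v: "v \<in> E3" for v
    proof -
      have "\<kappa> v \<in> {x + y |x y. x \<in> P \<and> y \<in> Q}" using L_eq L(5) E(6) v by blast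
      then obtain e f where ef: "e \<in> E1" "f \<in> E2" "\<kappa> v = \<kappa> e + \<kappa> f"
        unfolding E(4,5) by blast
      then have "v = e + f" using inj by (simp add: add[symmetric] inj_eq)
      then have "v \<in> vec.span (E1 \<union> E2)" using joinI ef by blast
      then show ?thesis using join_disjoint[OF E(1-3) E_ne] v by blast
    qed
    then have "E3 \<subseteq> {0}" by blast
    then have "vec.dim E3 \<le> vec.dim {0 :: 'a ^ 'd}" by (intro vec.dim_subset)
    then show False using dim_elem[OF E(3)] n_gt_1 by simp
  qed
  moreover have "\<O> = field_reduction ?\<phi> \<P>"
  proof -
    have "?\<phi> ` (\<kappa> ` F) = F" for F by (simp add: image_image \<phi>\<kappa>)
    then show ?thesis unfolding field_reduction_def \<P>_def by (simp add: image_image)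
  qed
  ultimately show ?thesis unfolding elementary_def by blast
qed

text \<open>The coordinates are \<open>p\<close>, \<open>r\<close> and \<open>r'\<close> moved back
  by \<theta>, so that all three use the field structure at \<open>Z\<close>.\<close>

lemma is_elementary: "elementary \<iota> \<O>"
proof -
  obtain X Y Z G where O: "X \<in> \<O>" "Y \<in> \<O>" "Z \<in> \<O>" "G \<in> \<O>" and dist: "distinct [X, Y, Z, G]"
    using oval_frame by blast
  have dZ: "distinct [Z, X, Y, G]" and dY: "distinct [Y, X, Z, G]" using dist by auto
  obtain p r where frZ: "frame_functionals Z X Y G p r"
    using frame_functionals_exist[OF O(3,1,2,4) dZ] by blast
  obtain p' r' where frY: "frame_functionals Y X Z G p' r'"
    using frame_functionals_exist[OF O(2,1,3,4) dY] by blast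
  note fZ = frZ O(3) O(1) O(2) O(4) dZ
  note fY = frY O(2) O(1) O(3) O(4) dY
  have "surj p" using functional_surj[OF frame_p[OF fZ] frame_p_ker[OF fZ]] O dist by auto
  moreover have "p v = 0 \<longleftrightarrow> p' v = 0" for v
    using frame_p_ker[OF fZ, of v] frame_p_ker[OF fY, of v] by (simp add: Un_commute)
  ultimately obtain \<theta> where \<theta>: "ext_linear_bij \<iota> \<theta>" "\<And>v. p' v = \<theta> (p v)"
    using ext_functional_comparison[OF frame_p[OF fZ] _ frame_p[OF fY]] by blast
  have univ: "multipliers \<theta> = UNIV"
    by (rule multipliers_eq_UNIV[OF O dist frZ frY \<theta>])
  define z where "z v = inv \<theta> (r' v)" for v
  have \<theta>': "ext_linear_bij \<iota> (inv \<theta>)" by (rule ext_linear_bij_inv_bij[OF \<theta>(1)])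
  have z_add: "z (u + v) = z u + z v" and z_scale: "z (c *s v) = \<iota> c * z v" for u v c
    unfolding z_def
    by (simp_all add: ext_functional_add[OF frame_r[OF fY]] ext_functional_scale[OF frame_r[OF fY]]
        ext_linear_bij_add[OF \<theta>'] ext_linear_bij_scale[OF \<theta>'])
  have z_0: "z v = 0 \<longleftrightarrow> v \<in> vec.span (Y \<union> X)" for v
    unfolding z_def using ext_linear_bij_eq_0_iff[OF \<theta>'] frame_r_ker[OF fY] by simp
  define \<kappa> :: "'a ^ 'd \<Rightarrow> 'k ^ 3" where "\<kappa> v = vector [p v, r v, z v]" for v
  have \<kappa>_eq: "\<kappa> v = w \<longleftrightarrow> p v = w $ 1 \<and> r v = w $ 2 \<and> z v = w $ 3" for v w
    unfolding \<kappa>_def by (simp add: vec_eq_iff forall_3 vector_3)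
  have range_eq: "\<kappa> ` F = range (\<lambda>c. c *s m)"
    if \<kappa>: "\<And>v. v \<in> F \<Longrightarrow> \<kappa> v = f v *s m" and f: "bij_betw f F UNIV" for F f m
  proof -
    have "\<kappa> ` F = (\<lambda>v. f v *s m) ` F" using \<kappa> by (rule image_cong[OF refl])
    also have "\<dots> = (\<lambda>c. c *s m) ` (f ` F)" by (simp add: image_image)
    finally show ?thesis using f by (simp add: bij_betw_def)
  qed
  show ?thesis
  proof (rule elementary_if_spaces[of \<kappa>])
    show "\<kappa> (u + v) = \<kappa> u + \<kappa> v" for u v
      unfolding \<kappa>_eq
      by (simp add: \<kappa>_def vector_3 z_add ext_functional_add[OF frame_p[OF fZ]] ext_functional_add[OF frame_r[OF fZ]])
    show "\<kappa> (c *s v) = \<iota> c *s \<kappa> v" for c v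
      unfolding \<kappa>_eq
      by (simp add: \<kappa>_def vector_3 z_scale ext_functional_scale[OF frame_p[OF fZ]]
          ext_functional_scale[OF frame_r[OF fZ]])
  next
    fix v assume "\<kappa> v = 0"
    then have "p v = 0" "r v = 0" "z v = 0" unfolding \<kappa>_eq by simp_all
    then have v: "v \<in> vec.span (Z \<union> Y)" "v \<in> vec.span (Z \<union> X)" "v \<in> vec.span (Y \<union> X)"
      using frame_p_ker[OF fZ] frame_r_ker[OF fZ] z_0 by simp_all
    \<comment> \<open>The first two kernels meet in \<open>Z\<close>, which misses the
      third.\<close>
    have "v \<in> Z" using joins_meet[of Z Y X v] O dist v by auto
    then show "v = 0" using join_disjoint[of Y X Z v] O dist v by auto
  next
    fix F assume F: "F \<in> \<O>"
    have "\<exists>m. m \<noteq> 0 \<and> \<kappa> ` F = range (\<lambda>c. c *s m)"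
    proof -
      \<comment> \<open>On \<open>Y\<close> and \<open>Z\<close> the coordinate \<open>p\<close>
        vanishes and another one is the parameter; \<open>X\<close> belongs to the third case, with
        slopes 0.\<close>
      consider "F = Y" | "F = Z" | "F \<noteq> Y" "F \<noteq> Z" by blast
      then show ?thesis
      proof cases
        case 1
        have "p v = 0" "z v = 0" if "v \<in> Y" for v
          using that frame_p_ker[OF fZ] z_0 by (simp_all add: vec.span_base)
        then have "\<kappa> v = r v *s vector [0, 1, 0]" if "v \<in> Y" for v
          using that unfolding \<kappa>_eq by (simp add: vector_3)
        moreover have "bij_betw r Y UNIV"
          using O dist by (intro functional_bij[OF frame_r[OF fZ] frame_r_ker[OF fZ]]) auto
        ultimately have "\<kappa> ` Y = range (\<lambda>c. c *s vector [0, 1, 0])" by (rule range_eq)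
        moreover have "(vector [0, 1, 0] :: 'k ^ 3) \<noteq> 0" by (simp add: vec_eq_iff forall_3 vector_3)
        ultimately show ?thesis using 1 by blast
      next
        case 2
        have "p v = 0" "r v = 0" if "v \<in> Z" for v
          using that frame_p_ker[OF fZ] frame_r_ker[OF fZ] by (simp_all add: vec.span_base)
        then have "\<kappa> v = z v *s vector [0, 0, 1]" if "v \<in> Z" for v
          using that unfolding \<kappa>_eq by (simp add: vector_3)
        moreover have "bij_betw z Z UNIV"
        proof -
          have "bij_betw r' Z UNIV"
            using O dist by (intro functional_bij[OF frame_r[OF fY] frame_r_ker[OF fY]]) auto
          moreover have "bij_betw (inv \<theta>) UNIV UNIV" using \<theta>' by (simp add: ext_linear_bij_def)
          ultimately have "bij_betw (inv \<theta> \<circ> r') Z UNIV" by (rule bij_betw_trans)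
          moreover have "inv \<theta> \<circ> r' = z" by (auto simp: z_def)
          ultimately show ?thesis by simp
        qed
        ultimately have "\<kappa> ` Z = range (\<lambda>c. c *s vector [0, 0, 1])" by (rule range_eq)
        moreover have "(vector [0, 0, 1] :: 'k ^ 3) \<noteq> 0" by (simp add: vec_eq_iff forall_3 vector_3)
        ultimately show ?thesis using 2 by blast
      next
        case 3
        obtain a where a: "\<forall>v\<in>F. r v = a * p v" using frame_coeff[OF fZ F 3(2,1)] by blast
        obtain b where b: "\<forall>v\<in>F. r' v = b * p' v" using frame_coeff[OF fY F 3] by blast
        \<comment> \<open>The slope \<open>b\<close> is pulled back to the structure at
          \<open>Z\<close>; here the equality of the two fields enters.\<close>
        obtain \<beta> where \<beta>: "\<And>y. \<theta> (\<beta> * y) = b * \<theta> y" using multiplier_ex[OF \<theta>(1) univ] by blast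
        have "z v = \<beta> * p v" if "v \<in> F" for v
          unfolding z_def using b that \<theta>(2) by (simp add: \<beta>[symmetric] ext_linear_bij_inv[OF \<theta>(1)])
        then have "\<kappa> v = p v *s vector [1, a, \<beta>]" if "v \<in> F" for v
          using that a unfolding \<kappa>_eq by (simp add: vector_3 mult.commute)
        moreover have "bij_betw p F UNIV" by (rule frame_p_bij[OF fZ F 3(2,1)])
        ultimately have "\<kappa> ` F = range (\<lambda>c. c *s vector [1, a, \<beta>])" by (rule range_eq)
        moreover have "(vector [1, a, \<beta>] :: 'k ^ 3) \<noteq> 0" by (simp add: vec_eq_iff forall_3 vector_3)
        ultimately show ?thesis by blast
      qed
    qed
    then show "is_space 1 (\<kappa> ` F)" unfolding is_space_1_iff .
  qed
qed

end

theorem mainTheorem1: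
  fixes \<iota> :: "'a::{field,finite} \<Rightarrow> 'k::{field,finite}"
    and \<O> :: "('a ^ 'd::finite) set set"
    and n h :: nat
  assumes "CARD('a) = 2 ^ h" and "h > 1" and "prime n"
    and "field_embedding \<iota>" and "CARD('k) = CARD('a) ^ n"
    and "CARD('d) = 3 * n"
    and "pseudo_oval n \<O>"
    and "\<And>E. E \<in> \<O> \<Longrightarrow> desarguesian_quot_spread \<iota> E (induced_spread n \<O> E)"
  shows "elementary \<iota> \<O>"
proof -
  \<comment> \<open>The bound q \<ge> 4 provides a scalar other than 0 and 1 and the count of slopes
    on a subline.\<close>
  have "(2 :: nat) ^ 2 \<le> 2 ^ h" using assms(2) by (intro power_increasing) auto
  then have "CARD('a) \<ge> 4" using assms(1) by simp
  moreover have "n > 1" using assms(3) by (rule prime_gt_1_nat)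
  ultimately interpret desarguesian_oval n \<O> \<iota>
    using assms by unfold_locales (auto simp: pseudo_oval_def)
  show ?thesis by (rule is_elementary)
qed

end
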